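(* Let $p$ be a prime and let $G$ be a $p$-central metabelian $p$-group. Then $\exp(M(G))\mid \exp(G)$.
   Context: $\exp(X)$ denotes the exponent of a group $X$ (the divisibility statement presupposes that $\exp(G)$ is finite). A group $G$ is $p$-central if the exponent of $G/Z(G)$ divides $p$, where $Z(G)$ is the center. $G$ is metabelian if its commutator subgroup is abelian. $M(G)=H_2(G,\mathbb{Z})$ is the Schur multiplier of $G$. *)

theory Defs
  imports "HOL-Algebra.Algebra"
begin

text \<open>The value 0 encodes an infinite exponent; it agrees with the divisibility order, in which
  0 is the top element.\<close>

definition exponent :: "('a, 'b) monoid_scheme \<Rightarrow> nat" where
  "exponent G =
     (if \<exists>n>0. \<forall>x\<in>carrier G. x [^]\<^bsub>G\<^esub> (n::nat) = \<one>\<^bsub>G\<^esub>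
      then LEAST n. n > 0 \<and> (\<forall>x\<in>carrier G. x [^]\<^bsub>G\<^esub> n = \<one>\<^bsub>G\<^esub>)
      else 0)"

definition center :: "('a, 'b) monoid_scheme \<Rightarrow> 'a set" where
  "center G = {z \<in> carrier G. \<forall>g\<in>carrier G. z \<otimes>\<^bsub>G\<^esub> g = g \<otimes>\<^bsub>G\<^esub> z}"

text \<open>Finiteness is not required: a \<open>p\<close>-group is a group all of whose elements have
  \<open>p\<close>-power order (\<open>group.ord\<close> is 0 for elements of infinite order).\<close>

definition p_group :: "nat \<Rightarrow> ('a, 'b) monoid_scheme \<Rightarrow> bool" where
  "p_group p G \<longleftrightarrow> group G \<and> (\<forall>x\<in>carrier G. \<exists>k. group.ord G x = p ^ k)"

definition p_central :: "nat \<Rightarrow> ('a, 'b) monoid_scheme \<Rightarrow> bool" where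
  "p_central p G \<longleftrightarrow> exponent (G Mod center G) dvd p"

definition metabelian :: "('a, 'b) monoid_scheme \<Rightarrow> bool" where
  "metabelian G \<longleftrightarrow> comm_group (G\<lparr>carrier := derived G (carrier G)\<rparr>)"

text \<open>The Schur multiplier is the second homology of the inhomogeneous bar complex with trivial
  integer coefficients. Its chains of degree \<open>n\<close> form the free abelian group on the symbols
  \<open>[g\<^sub>1|\<dots>|g\<^sub>n]\<close>, represented here as tuples of elements of \<open>G\<close>, and
    \<open>d [g\<^sub>1|\<dots>|g\<^sub>n] = [g\<^sub>2|\<dots>|g\<^sub>n]
       + (\<Sum>i=1..<n. (-1)^i [g\<^sub>1|\<dots>|g\<^sub>i g\<^sub>i\<^sub>+\<^sub>1|\<dots>|g\<^sub>n])
       + (-1)^n [g\<^sub>1|\<dots>|g\<^sub>n\<^sub>-\<^sub>1]\<close>.\<close>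

definition bar_d2 :: "('a, 'b) monoid_scheme \<Rightarrow> ('a \<times> 'a \<Rightarrow>\<^sub>0 int) \<Rightarrow> ('a \<Rightarrow>\<^sub>0 int)" where
  "bar_d2 G = frag_extend (\<lambda>(g, h). frag_of h - frag_of (g \<otimes>\<^bsub>G\<^esub> h) + frag_of g)"

definition bar_d3 ::
    "('a, 'b) monoid_scheme \<Rightarrow> ('a \<times> 'a \<times> 'a \<Rightarrow>\<^sub>0 int) \<Rightarrow> ('a \<times> 'a \<Rightarrow>\<^sub>0 int)" where
  "bar_d3 G = frag_extend (\<lambda>(g, h, k).
     frag_of (h, k) - frag_of (g \<otimes>\<^bsub>G\<^esub> h, k) + frag_of (g, h \<otimes>\<^bsub>G\<^esub> k) - frag_of (g, h))"

definition schur_cycles :: "('a, 'b) monoid_scheme \<Rightarrow> ('a \<times> 'a \<Rightarrow>\<^sub>0 int) set" where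
  "schur_cycles G =
     kernel (free_Abelian_group (carrier G \<times> carrier G)) (free_Abelian_group (carrier G)) (bar_d2 G)"

definition schur_boundaries :: "('a, 'b) monoid_scheme \<Rightarrow> ('a \<times> 'a \<Rightarrow>\<^sub>0 int) set" where
  "schur_boundaries G =
     bar_d3 G ` carrier (free_Abelian_group (carrier G \<times> carrier G \<times> carrier G))"

definition schur_multiplier :: "('a, 'b) monoid_scheme \<Rightarrow> ('a \<times> 'a \<Rightarrow>\<^sub>0 int) set monoid" where
  "schur_multiplier G =
     (free_Abelian_group (carrier G \<times> carrier G))\<lparr>carrier := schur_cycles G\<rparr> Mod schur_boundaries G"

lemma bar_d2_hom:
  assumes "group G"
  shows "bar_d2 G \<in> hom (free_Abelian_group (carrier G \<times> carrier G)) (free_Abelian_group (carrier G))"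
proof -
  interpret group G by fact
  have "Poly_Mapping.keys (bar_d2 G c) \<subseteq> carrier G"
    if "Poly_Mapping.keys c \<subseteq> carrier G \<times> carrier G" for c
  proof -
    have "Poly_Mapping.keys (frag_of h - frag_of (g \<otimes>\<^bsub>G\<^esub> h) + frag_of g) \<subseteq> carrier G"
      if "g \<in> carrier G" "h \<in> carrier G" for g h
      using that keys_add[of "frag_of h - frag_of (g \<otimes>\<^bsub>G\<^esub> h)" "frag_of g"]
        keys_diff[of "frag_of h" "frag_of (g \<otimes>\<^bsub>G\<^esub> h)"] by auto
    then have "\<forall>x\<in>carrier G \<times> carrier G.
        Poly_Mapping.keys (case x of (g, h) \<Rightarrow> frag_of h - frag_of (g \<otimes>\<^bsub>G\<^esub> h) + frag_of g) \<subseteq> carrier G"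
      unfolding Ball_def mem_Times_iff split_beta by blast
    with that show ?thesis
      unfolding bar_d2_def by (intro order_trans[OF keys_frag_extend] UN_least) blast
  qed
  then show ?thesis
    by (auto simp: hom_def bar_d2_def frag_extend_add)
qed

lemma bar_d3_hom:
  assumes "group G"
  shows "bar_d3 G \<in> hom (free_Abelian_group (carrier G \<times> carrier G \<times> carrier G))
                         (free_Abelian_group (carrier G \<times> carrier G))"
proof -
  interpret group G by fact
  have "Poly_Mapping.keys (bar_d3 G c) \<subseteq> carrier G \<times> carrier G"
    if "Poly_Mapping.keys c \<subseteq> carrier G \<times> carrier G \<times> carrier G" for c
  proof -
    have "Poly_Mapping.keys (frag_of (h, k) - frag_of (g \<otimes>\<^bsub>G\<^esub> h, k)
            + frag_of (g, h \<otimes>\<^bsub>G\<^esub> k) - frag_of (g, h)) \<subseteq> carrier G \<times> carrier G"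
      if "g \<in> carrier G" "h \<in> carrier G" "k \<in> carrier G" for g h k
      using that
        keys_diff[of "frag_of (h, k) - frag_of (g \<otimes>\<^bsub>G\<^esub> h, k) + frag_of (g, h \<otimes>\<^bsub>G\<^esub> k)" "frag_of (g, h)"]
        keys_add[of "frag_of (h, k) - frag_of (g \<otimes>\<^bsub>G\<^esub> h, k)" "frag_of (g, h \<otimes>\<^bsub>G\<^esub> k)"]
        keys_diff[of "frag_of (h, k)" "frag_of (g \<otimes>\<^bsub>G\<^esub> h, k)"] by auto
    then have "\<forall>x\<in>carrier G \<times> carrier G \<times> carrier G.
        Poly_Mapping.keys (case x of (g, h, k) \<Rightarrow> frag_of (h, k) - frag_of (g \<otimes>\<^bsub>G\<^esub> h, k)
          + frag_of (g, h \<otimes>\<^bsub>G\<^esub> k) - frag_of (g, h)) \<subseteq> carrier G \<times> carrier G"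
      unfolding Ball_def mem_Times_iff split_beta by blast
    with that show ?thesis
      unfolding bar_d3_def by (intro order_trans[OF keys_frag_extend] UN_least) blast
  qed
  then show ?thesis
    by (auto simp: hom_def bar_d3_def frag_extend_add)
qed

lemma bar_d2_d3:
  assumes "group G" "Poly_Mapping.keys c \<subseteq> carrier G \<times> carrier G \<times> carrier G"
  shows "bar_d2 G (bar_d3 G c) = 0"
  using assms(2)
proof (induction c rule: frag_induction)
  case (one x)
  then show ?case
    using group.is_monoid[OF assms(1)]
    by (auto simp: bar_d2_def bar_d3_def frag_extend_add frag_extend_diff monoid.m_assoc)
next
  case (diff a b)
  then show ?case
    by (simp add: bar_d2_def bar_d3_def frag_extend_diff)
qed (simp add: bar_d2_def bar_d3_def)

lemma subgroup_schur_cycles: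
  assumes "group G"
  shows "subgroup (schur_cycles G) (free_Abelian_group (carrier G \<times> carrier G))"
  unfolding schur_cycles_def
  using bar_d2_hom[OF assms]
  by (intro group_hom.subgroup_kernel) (simp add: group_hom_def group_hom_axioms_def)

lemma subgroup_schur_boundaries:
  assumes "group G"
  shows "subgroup (schur_boundaries G) (free_Abelian_group (carrier G \<times> carrier G))"
  unfolding schur_boundaries_def
  using bar_d3_hom[OF assms]
  by (intro group_hom.img_is_subgroup) (simp add: group_hom_def group_hom_axioms_def)

lemma schur_boundaries_subset_cycles:
  assumes "group G"
  shows "schur_boundaries G \<subseteq> schur_cycles G"
  using bar_d2_d3[OF assms] bar_d3_hom[OF assms]
  by (auto simp: schur_boundaries_def schur_cycles_def kernel_def hom_def Pi_iff)

lemma comm_group_schur_multiplier: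
  assumes "group G"
  shows "comm_group (schur_multiplier G)"
proof -
  let ?F = "free_Abelian_group (carrier G \<times> carrier G)"
  let ?Z = "?F\<lparr>carrier := schur_cycles G\<rparr>"
  have "group ?Z"
    using subgroup.subgroup_is_group[OF subgroup_schur_cycles[OF assms] group_free_Abelian_group] .
  then have Z: "comm_group ?Z"
    by (rule group.group_comm_groupI) (simp add: add.commute)
  have "subgroup (schur_boundaries G) ?Z"
    using group.subgroup_incl[OF group_free_Abelian_group subgroup_schur_boundaries[OF assms]
        subgroup_schur_cycles[OF assms] schur_boundaries_subset_cycles[OF assms]] .
  then show ?thesis
    unfolding schur_multiplier_def using comm_group.abelian_FactGroup[OF Z] by blast
qed

end

(*
  The class of [g|h] in the group A of 2-chains modulo boundaries is a 2-cocycle, so it defines a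
  central extension E of G by A.  The abelianization of E is free abelian on the elements of G, and
  A maps to it by the boundary map; hence cycles lie in the derived subgroup M of E, and it suffices
  that M has exponent dividing e = exp(G).

  In E the commutators [x^p,y] are central and killed by e/p, p-th powers commute with M, and M has
  class at most two with commutators of order dividing p.  The Baer correspondence turns M into an
  abelian group written additively.  Put c = [x,y].  Up to a correction by commutators of conjugates
  of c, the element [z^p,y] with z = y^j x is the sum N_z of the conjugates of c by 1, z, ..., z^(p-1).
  The lines spanned by the y^j x and y cover the plane spanned by x and y, every nonzero vector
  exactly once, so the sum over j of N_{y^j x} is pc + (p-1) N_y.  Thus pc is killed by e/p up to a
  correction of order p.  That correction matters only for e = p; then pc equals half of a first
  moment along the line of y, and comparing the moments along all lines shows that it vanishes.
*)
theory Submission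
  imports Defs "HOL-Number_Theory.Cong"
begin

section \<open>Commutator calculus\<close>

text \<open>The obstacle is that E is only central-by-metabelian. If M were abelian, x and y would
  act on it through the plane, and the count of lines would be an identity in a group ring. Here
  elements of M act on M by central shears, so (y^j x)^i and y^(ij) x^i may act differently on c.
  The Baer sum makes these errors additive: each is a difference of two values of one function of
  period p, and the sum over j cancels them. Commutators [c, c^g] ignore changes of g by M, so they
  are functions on the plane and can be reindexed freely; the moments are built from them. Nothing
  is lost in passing to the Baer group: it has the inverses and powers of M, and conjugation by E
  acts on it by automorphisms.\<close>

context group
begin

definition conj_by :: "'a \<Rightarrow> 'a \<Rightarrow> 'a" (infixl "\<^bold>^" 75)
  where "a \<^bold>^ g = inv g \<otimes> a \<otimes> g"

definition commutator :: "'a \<Rightarrow> 'a \<Rightarrow> 'a" ("(\<lblot>_,/ _\<rblot>)")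
  where "\<lblot>a, b\<rblot> = inv a \<otimes> inv b \<otimes> a \<otimes> b"

lemma conj_by_closed [simp, intro]:
  "a \<in> carrier G \<Longrightarrow> g \<in> carrier G \<Longrightarrow> a \<^bold>^ g \<in> carrier G"
  by (simp add: conj_by_def)

lemma commutator_closed [simp, intro]:
  "a \<in> carrier G \<Longrightarrow> b \<in> carrier G \<Longrightarrow> \<lblot>a, b\<rblot> \<in> carrier G"
  by (simp add: commutator_def)

lemma mult_inv_cancel [simp]:
  assumes "a \<in> carrier G" "b \<in> carrier G"
  shows "a \<otimes> (inv a \<otimes> b) = b" "inv a \<otimes> (a \<otimes> b) = b"
  using assms by (simp_all add: m_assoc[symmetric])

lemmas word_simps = conj_by_def commutator_def m_assoc inv_mult_group

lemma conj_by_mult: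
  assumes "a \<in> carrier G" "b \<in> carrier G" "g \<in> carrier G"
  shows "(a \<otimes> b) \<^bold>^ g = (a \<^bold>^ g) \<otimes> (b \<^bold>^ g)"
  using assms by (simp add: word_simps)

lemma conj_by_inv:
  assumes "a \<in> carrier G" "g \<in> carrier G"
  shows "(inv a) \<^bold>^ g = inv (a \<^bold>^ g)"
  using assms by (simp add: word_simps)

lemma conj_by_one [simp]:
  "a \<in> carrier G \<Longrightarrow> a \<^bold>^ \<one> = a" "g \<in> carrier G \<Longrightarrow> \<one> \<^bold>^ g = \<one>"
  by (simp_all add: word_simps)

lemma conj_by_conj_by:
  assumes "a \<in> carrier G" "g \<in> carrier G" "h \<in> carrier G"
  shows "a \<^bold>^ g \<^bold>^ h = a \<^bold>^ (g \<otimes> h)"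
  using assms by (simp add: word_simps)

lemma conj_by_pow:
  assumes "a \<in> carrier G" "g \<in> carrier G"
  shows "(a [^] n) \<^bold>^ g = (a \<^bold>^ g) [^] (n::nat)"
  using assms by (induction n) (simp_all add: conj_by_mult)

lemma conj_by_commutator:
  assumes "a \<in> carrier G" "b \<in> carrier G" "g \<in> carrier G"
  shows "\<lblot>a, b\<rblot> \<^bold>^ g = \<lblot>a \<^bold>^ g, b \<^bold>^ g\<rblot>"
  using assms by (simp add: word_simps)

lemma conj_by_eq_mult_commutator:
  assumes "a \<in> carrier G" "g \<in> carrier G"
  shows "a \<^bold>^ g = a \<otimes> \<lblot>a, g\<rblot>"
  using assms by (simp add: word_simps)

lemma commutator_mult_left:
  assumes "a \<in> carrier G" "b \<in> carrier G" "d \<in> carrier G"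
  shows "\<lblot>a \<otimes> b, d\<rblot> = (\<lblot>a, d\<rblot> \<^bold>^ b) \<otimes> \<lblot>b, d\<rblot>"
  using assms by (simp add: word_simps)

lemma commutator_mult_right:
  assumes "a \<in> carrier G" "b \<in> carrier G" "d \<in> carrier G"
  shows "\<lblot>a, b \<otimes> d\<rblot> = \<lblot>a, d\<rblot> \<otimes> (\<lblot>a, b\<rblot> \<^bold>^ d)"
  using assms by (simp add: word_simps)

lemma inv_commutator:
  assumes "a \<in> carrier G" "b \<in> carrier G"
  shows "inv \<lblot>a, b\<rblot> = \<lblot>b, a\<rblot>"
  using assms by (simp add: word_simps)

lemma commutator_swap:
  assumes "a \<in> carrier G" "b \<in> carrier G"
  shows "a \<otimes> b = b \<otimes> a \<otimes> \<lblot>a, b\<rblot>"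
  using assms by (simp add: word_simps)

lemma commutator_one [simp]:
  "a \<in> carrier G \<Longrightarrow> \<lblot>a, \<one>\<rblot> = \<one>" "a \<in> carrier G \<Longrightarrow> \<lblot>\<one>, a\<rblot> = \<one>" "a \<in> carrier G \<Longrightarrow> \<lblot>a, a\<rblot> = \<one>"
  by (simp_all add: word_simps)

lemma commutator_eq_one_iff:
  assumes "a \<in> carrier G" "b \<in> carrier G"
  shows "\<lblot>a, b\<rblot> = \<one> \<longleftrightarrow> a \<otimes> b = b \<otimes> a"
proof
  assume "\<lblot>a, b\<rblot> = \<one>"
  then show "a \<otimes> b = b \<otimes> a" using commutator_swap[of a b] assms by simp
next
  assume *: "a \<otimes> b = b \<otimes> a"
  have "\<lblot>a, b\<rblot> = inv (b \<otimes> a) \<otimes> (a \<otimes> b)" using assms by (simp add: word_simps)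
  then show "\<lblot>a, b\<rblot> = \<one>" using assms * by simp
qed

lemma inv_commute:
  assumes "x \<in> carrier G" "g \<in> carrier G" "x \<otimes> g = g \<otimes> x"
  shows "inv x \<otimes> g = g \<otimes> inv x"
proof -
  have "inv x \<otimes> (g \<otimes> x) \<otimes> inv x = inv x \<otimes> (x \<otimes> g) \<otimes> inv x"
    using assms by simp
  then show ?thesis using assms(1,2) by (simp add: m_assoc)
qed

lemma center_closed: "z \<in> center G \<Longrightarrow> z \<in> carrier G"
  by (simp add: center_def)

lemma center_commute: "z \<in> center G \<Longrightarrow> g \<in> carrier G \<Longrightarrow> z \<otimes> g = g \<otimes> z"
  by (simp add: center_def)

lemma center_lcommute:
  assumes "z \<in> center G" "g \<in> carrier G" "h \<in> carrier G"
  shows "z \<otimes> (g \<otimes> h) = g \<otimes> (z \<otimes> h)"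
  using assms center_commute[of z g] by (simp add: m_assoc[symmetric] center_closed)

lemma conj_by_center: "z \<in> center G \<Longrightarrow> g \<in> carrier G \<Longrightarrow> z \<^bold>^ g = z"
  using center_commute[of z g] by (simp add: conj_by_def m_assoc center_closed)

lemma centerI: "z \<in> carrier G \<Longrightarrow> (\<And>g. g \<in> carrier G \<Longrightarrow> z \<otimes> g = g \<otimes> z) \<Longrightarrow> z \<in> center G"
  by (simp add: center_def)

lemma subgroup_center: "subgroup (center G) G"
proof
  show "x \<otimes> y \<in> center G" if xy: "x \<in> center G" "y \<in> center G" for x y
  proof (rule centerI)
    fix g assume g: "g \<in> carrier G"
    show "x \<otimes> y \<otimes> g = g \<otimes> (x \<otimes> y)"
      using xy[THEN center_closed] g center_lcommute[OF xy(1) g, of y] center_commute[OF xy(2) g]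
      by (simp add: m_assoc)
  qed (use xy center_closed in simp)
  show "inv x \<in> center G" if x: "x \<in> center G" for x
    using center_closed[OF x] center_commute[OF x] by (intro centerI inv_commute inv_closed)
qed (auto intro: centerI center_closed)

lemma center_pow: "z \<in> center G \<Longrightarrow> z [^] (n::nat) \<in> center G"
  by (induction n) (auto intro: subgroup.one_closed subgroup.m_closed subgroup_center)

lemma conj_by_center_right: "z \<in> center G \<Longrightarrow> g \<in> carrier G \<Longrightarrow> g \<^bold>^ z = g"
  using center_commute[of z g, symmetric] by (simp add: conj_by_def m_assoc center_closed)

lemma commutator_mult_center:
  assumes "z \<in> center G" "a \<in> carrier G" "b \<in> carrier G"
  shows "\<lblot>a \<otimes> z, b\<rblot> = \<lblot>a, b\<rblot>" "\<lblot>a, b \<otimes> z\<rblot> = \<lblot>a, b\<rblot>"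
proof -
  have "\<lblot>z, b\<rblot> = \<one>" "\<lblot>a, z\<rblot> = \<one>"
    using assms by (auto simp: commutator_eq_one_iff center_closed center_commute)
  then show "\<lblot>a \<otimes> z, b\<rblot> = \<lblot>a, b\<rblot>" "\<lblot>a, b \<otimes> z\<rblot> = \<lblot>a, b\<rblot>"
    using assms by (simp_all add: commutator_mult_left commutator_mult_right center_closed
      conj_by_center_right)
qed

lemma commutator_pow_left:
  assumes "a \<in> carrier G" "b \<in> carrier G" "\<lblot>a, b\<rblot> \<in> center G"
  shows "\<lblot>a [^] (n::nat), b\<rblot> = \<lblot>a, b\<rblot> [^] n"
  using assms
proof (induction n)
  case (Suc n)
  then have "\<lblot>a [^] n, b\<rblot> \<in> center G" by (simp add: center_pow)
  then show ?case using Suc by (simp add: commutator_mult_left conj_by_center)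
qed simp

text \<open>The generators of \<open>derived\<close> have the shape h1 h2 h1^-1 h2^-1, which in the
  present convention is the commutator of the inverses.\<close>

lemma commutator_in_derived:
  assumes "a \<in> carrier G" "b \<in> carrier G"
  shows "\<lblot>a, b\<rblot> \<in> derived G (carrier G)"
proof -
  have "\<lblot>a, b\<rblot> = inv a \<otimes> inv b \<otimes> inv (inv a) \<otimes> inv (inv b)"
    using assms by (simp add: commutator_def)
  then show ?thesis
    unfolding derived_def using assms
    by (intro generate.incl UN_I[of "inv a"] UN_I[of "inv b"]) auto
qed

lemma derived_subset_subgroup:
  assumes "subgroup H G" "\<And>a b. a \<in> carrier G \<Longrightarrow> b \<in> carrier G \<Longrightarrow> \<lblot>a, b\<rblot> \<in> H"
  shows "derived G (carrier G) \<subseteq> H"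
proof -
  have "h1 \<otimes> h2 \<otimes> inv h1 \<otimes> inv h2 \<in> H" if "h1 \<in> carrier G" "h2 \<in> carrier G" for h1 h2
    using assms(2)[of "inv h1" "inv h2"] that by (simp add: commutator_def)
  then show ?thesis
    unfolding derived_def by (intro generate_subgroup_incl[OF _ assms(1)]) auto
qed

lemma subgroup_centralizer:
  assumes "q \<in> carrier G"
  shows "subgroup {u \<in> carrier G. q \<otimes> u = u \<otimes> q} G"
proof
  show "inv x \<in> {u \<in> carrier G. q \<otimes> u = u \<otimes> q}" if "x \<in> {u \<in> carrier G. q \<otimes> u = u \<otimes> q}" for x
    using that assms by (auto intro: inv_commute[symmetric])
  show "x \<otimes> y \<in> {u \<in> carrier G. q \<otimes> u = u \<otimes> q}"
    if "x \<in> {u \<in> carrier G. q \<otimes> u = u \<otimes> q}" "y \<in> {u \<in> carrier G. q \<otimes> u = u \<otimes> q}" for x y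
    using that assms by (simp add: m_assoc[symmetric]) (simp add: m_assoc)
qed (use assms in auto)

text \<open>Conjugation by \<open>q\<close> multiplies every element by a central factor, and such factors cancel in
  commutators.\<close>

lemma second_center_commutes_derived:
  assumes q: "q \<in> carrier G" and c: "\<And>a. a \<in> carrier G \<Longrightarrow> \<lblot>q, a\<rblot> \<in> center G"
    and u: "u \<in> derived G (carrier G)"
  shows "q \<otimes> u = u \<otimes> q"
proof -
  have "q \<otimes> \<lblot>a, b\<rblot> = \<lblot>a, b\<rblot> \<otimes> q" if ab: "a \<in> carrier G" "b \<in> carrier G" for a b
  proof -
    have cq: "\<lblot>a, q\<rblot> \<in> center G" if "a \<in> carrier G" for a
      using subgroup.m_inv_closed[OF subgroup_center c[OF that]] that q by (simp add: inv_commutator)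
    have "\<lblot>a, b\<rblot> \<^bold>^ q = \<lblot>a \<otimes> \<lblot>a, q\<rblot>, b \<otimes> \<lblot>b, q\<rblot>\<rblot>"
      using ab q by (simp add: conj_by_commutator conj_by_eq_mult_commutator[symmetric])
    also have "\<dots> = \<lblot>a, b\<rblot>"
      using ab q cq by (simp add: commutator_mult_center)
    finally have "\<lblot>\<lblot>a, b\<rblot>, q\<rblot> = \<one>"
      using ab q conj_by_eq_mult_commutator[of "\<lblot>a, b\<rblot>" q] by simp
    then show ?thesis using ab q by (simp add: commutator_eq_one_iff)
  qed
  then have "derived G (carrier G) \<subseteq> {u \<in> carrier G. q \<otimes> u = u \<otimes> q}"
    using q by (intro derived_subset_subgroup subgroup_centralizer) auto
  then show ?thesis using u by auto
qed

end

section \<open>The Baer group of the derived subgroup\<close>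

text \<open>In the application \<open>G\<close> is a central extension of a \<open>p\<close>-central metabelian group.\<close>

locale p_central_metabelian_cover = group +
  fixes p :: nat
  assumes prime_p: "Factorial_Ring.prime p"
    and commutator_pow_p_central:
      "x \<in> carrier G \<Longrightarrow> y \<in> carrier G \<Longrightarrow> \<lblot>x [^] p, y\<rblot> \<in> center G"
    and derived_commutator_central:
      "u \<in> derived G (carrier G) \<Longrightarrow> v \<in> derived G (carrier G) \<Longrightarrow> \<lblot>u, v\<rblot> \<in> center G"
begin

abbreviation M :: "'a set" where "M \<equiv> derived G (carrier G)"

lemma subgroup_M: "subgroup M G"
  by (simp add: derived_is_subgroup)

lemma M_carrier [simp, intro]: "u \<in> M \<Longrightarrow> u \<in> carrier G"
  using subgroup_M by (rule subgroup.mem_carrier)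

lemma M_mult [simp, intro]: "u \<in> M \<Longrightarrow> v \<in> M \<Longrightarrow> u \<otimes> v \<in> M"
  using subgroup_M by (rule subgroup.m_closed)

lemma M_inv [simp, intro]: "u \<in> M \<Longrightarrow> inv u \<in> M"
  using subgroup_M by (rule subgroup.m_inv_closed)

lemma M_one [simp, intro]: "\<one> \<in> M"
  using subgroup_M by (rule subgroup.one_closed)

lemma M_pow [simp, intro]: "u \<in> M \<Longrightarrow> u [^] (n::nat) \<in> M"
  by (induction n) auto

lemma M_commutator [simp, intro]: "a \<in> carrier G \<Longrightarrow> b \<in> carrier G \<Longrightarrow> \<lblot>a, b\<rblot> \<in> M"
  by (rule commutator_in_derived)

lemma M_conj_by [simp, intro]: "u \<in> M \<Longrightarrow> g \<in> carrier G \<Longrightarrow> u \<^bold>^ g \<in> M"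
  by (simp add: conj_by_eq_mult_commutator)

lemma p_pos: "p > 0" and p_gt_1: "p > Suc 0"
  using prime_p by (simp_all add: prime_gt_0_nat prime_gt_Suc_0_nat)

lemma pow_p_commutes_M:
  assumes "x \<in> carrier G" "u \<in> M"
  shows "x [^] p \<otimes> u = u \<otimes> x [^] p"
  using assms by (intro second_center_commutes_derived commutator_pow_p_central) auto

lemma conj_by_pow_p [simp]:
  assumes "x \<in> carrier G" "u \<in> M"
  shows "u \<^bold>^ (x [^] p) = u"
  using pow_p_commutes_M[OF assms] assms by (simp add: conj_by_def m_assoc flip: pow_p_commutes_M)

lemma M_commutator_central: "u \<in> M \<Longrightarrow> v \<in> M \<Longrightarrow> \<lblot>u, v\<rblot> \<in> center G"
  by (rule derived_commutator_central)

lemma M_commutator_mult_left: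
  assumes "u \<in> M" "v \<in> M" "w \<in> M"
  shows "\<lblot>u \<otimes> v, w\<rblot> = \<lblot>u, w\<rblot> \<otimes> \<lblot>v, w\<rblot>"
  using assms by (simp add: commutator_mult_left conj_by_center M_commutator_central)

lemma M_commutator_mult_right:
  assumes "u \<in> M" "v \<in> M" "w \<in> M"
  shows "\<lblot>u, v \<otimes> w\<rblot> = \<lblot>u, v\<rblot> \<otimes> \<lblot>u, w\<rblot>"
  using assms center_commute[OF M_commutator_central[of u v], of "\<lblot>u, w\<rblot>"]
  by (simp add: commutator_mult_right conj_by_center M_commutator_central)

text \<open>The commutator is central, so the exponent p moves into its first argument, and p-th
  powers commute with \<open>M\<close>.\<close>

lemma M_commutator_pow_p [simp]:
  assumes "u \<in> M" "v \<in> M"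
  shows "\<lblot>u, v\<rblot> [^] p = \<one>"
proof -
  have "\<lblot>u, v\<rblot> [^] p = \<lblot>u [^] p, v\<rblot>"
    using assms by (simp add: commutator_pow_left M_commutator_central)
  also have "\<dots> = \<one>"
    using assms by (simp add: commutator_eq_one_iff pow_p_commutes_M)
  finally show ?thesis .
qed

text \<open>A commutator is a product of squares, \<open>[a, b] = a\<^sup>-\<^sup>2 (ab\<^sup>-\<^sup>1)\<^sup>2 b\<^sup>2\<close>, and squares commute with \<open>M\<close>.\<close>

lemma M_commute_if_p_eq_2:
  assumes "p = 2" "u \<in> M" "v \<in> M"
  shows "\<lblot>u, v\<rblot> = \<one>"
proof -
  have "M \<subseteq> {w \<in> carrier G. v \<otimes> w = w \<otimes> v}"
  proof (intro derived_subset_subgroup subgroup_centralizer)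
    fix a b assume ab: "a \<in> carrier G" "b \<in> carrier G"
    have sq: "x [^] (2::nat) = x \<otimes> x" if "x \<in> carrier G" for x
      using that by (simp add: numeral_2_eq_2)
    have "inv a [^] (2::nat) \<in> {w \<in> carrier G. v \<otimes> w = w \<otimes> v}"
      "(a \<otimes> inv b) [^] (2::nat) \<in> {w \<in> carrier G. v \<otimes> w = w \<otimes> v}"
      "b [^] (2::nat) \<in> {w \<in> carrier G. v \<otimes> w = w \<otimes> v}"
      using assms ab pow_p_commutes_M[of "inv a" v] pow_p_commutes_M[of "a \<otimes> inv b" v]
        pow_p_commutes_M[of b v] by auto
    then have "inv a [^] (2::nat) \<otimes> (a \<otimes> inv b) [^] (2::nat) \<otimes> b [^] (2::nat)
        \<in> {w \<in> carrier G. v \<otimes> w = w \<otimes> v}"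
      using assms by (intro subgroup.m_closed[OF subgroup_centralizer]) auto
    also have "inv a [^] (2::nat) \<otimes> (a \<otimes> inv b) [^] (2::nat) \<otimes> b [^] (2::nat) = \<lblot>a, b\<rblot>"
      using ab by (simp add: sq word_simps)
    finally show "\<lblot>a, b\<rblot> \<in> {w \<in> carrier G. v \<otimes> w = w \<otimes> v}" .
  qed (use assms in auto)
  then show ?thesis using assms by (auto simp: commutator_eq_one_iff)
qed

definition half :: nat where "half = (p + 1) div 2"

text \<open>For odd p two halves add up to p + 1, and the commutator has order dividing p; for p = 2
  it is trivial.\<close>

lemma M_commutator_pow_half:
  assumes "u \<in> M" "v \<in> M"
  shows "\<lblot>u, v\<rblot> [^] half \<otimes> \<lblot>u, v\<rblot> [^] half = \<lblot>u, v\<rblot>"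
proof (cases "p = 2")
  case True
  then show ?thesis using M_commute_if_p_eq_2 assms by simp
next
  case False
  then have "odd p" using prime_p primes_dvd_imp_eq two_is_prime_nat by blast
  then have *: "half + half = Suc p" unfolding half_def by presburger
  have "\<lblot>u, v\<rblot> [^] half \<otimes> \<lblot>u, v\<rblot> [^] half = \<lblot>u, v\<rblot> [^] Suc p"
    using assms by (subst nat_pow_mult) (auto simp: * simp del: nat_pow_Suc)
  then show ?thesis using assms by simp
qed

text \<open>The Baer correspondence: the product \<open>ab[b,a]\<^sup>1\<^sup>/\<^sup>2\<close> makes a group of class two abelian. The
  constant \<open>half\<close> inverts 2 modulo odd \<open>p\<close>; for \<open>p = 2\<close> the commutators are trivial.\<close>

definition baer :: "'a monoid" where
  "baer = \<lparr>carrier = M, monoid.mult = \<lambda>a b. a \<otimes> b \<otimes> \<lblot>b, a\<rblot> [^] half, one = \<one>\<rparr>"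

lemma carrier_baer [simp]: "carrier baer = M"
  and one_baer [simp]: "\<one>\<^bsub>baer\<^esub> = \<one>"
  and mult_baer: "a \<otimes>\<^bsub>baer\<^esub> b = a \<otimes> b \<otimes> \<lblot>b, a\<rblot> [^] half"
  by (simp_all add: baer_def)

lemma half_central: "u \<in> M \<Longrightarrow> v \<in> M \<Longrightarrow> \<lblot>u, v\<rblot> [^] half \<in> center G"
  by (intro center_pow M_commutator_central)

lemma half_mult_left:
  assumes "u \<in> M" "v \<in> M" "w \<in> M"
  shows "\<lblot>u \<otimes> v, w\<rblot> [^] half = \<lblot>u, w\<rblot> [^] half \<otimes> \<lblot>v, w\<rblot> [^] half"
  using assms
  by (simp add: M_commutator_mult_left)
   (metis M_commutator_central center_commute M_carrier M_commutator pow_mult_distrib)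

lemma half_mult_right:
  assumes "u \<in> M" "v \<in> M" "w \<in> M"
  shows "\<lblot>u, v \<otimes> w\<rblot> [^] half = \<lblot>u, v\<rblot> [^] half \<otimes> \<lblot>u, w\<rblot> [^] half"
  using assms
  by (simp add: M_commutator_mult_right)
   (metis M_commutator_central center_commute M_carrier M_commutator pow_mult_distrib)

lemma baer_comm:
  assumes "u \<in> M" "v \<in> M"
  shows "u \<otimes>\<^bsub>baer\<^esub> v = v \<otimes>\<^bsub>baer\<^esub> u"
proof -
  let ?z = "\<lblot>u, v\<rblot> [^] half"
  have z: "\<lblot>v, u\<rblot> [^] half = inv ?z"
    using assms by (simp add: nat_pow_inv flip: inv_commutator[of u v])
  \<comment> \<open>Swapping the factors costs the square of ?z, of which the Baer correction takes
    back one factor; the result is symmetric.\<close>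
  have "u \<otimes> v = v \<otimes> u \<otimes> (?z \<otimes> ?z)"
    using assms commutator_swap[of u v] M_commutator_pow_half[of u v] by simp
  then have "u \<otimes>\<^bsub>baer\<^esub> v = v \<otimes> u \<otimes> (?z \<otimes> ?z) \<otimes> inv ?z"
    by (simp add: mult_baer z)
  also have "\<dots> = v \<otimes>\<^bsub>baer\<^esub> u"
    using assms by (simp add: mult_baer m_assoc)
  finally show ?thesis .
qed

lemma comm_group_baer: "comm_group baer"
proof (rule comm_groupI; simp?)
  fix u v w assume M: "u \<in> M" "v \<in> M" "w \<in> M"
  note c = M_commutator_central half_central center_closed
  \<comment> \<open>By bilinearity both bracketings are u v w times the same three central
    halves.\<close>
  have l: "(u \<otimes>\<^bsub>baer\<^esub> v) \<otimes>\<^bsub>baer\<^esub> w =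
     u \<otimes> v \<otimes> \<lblot>v, u\<rblot> [^] half \<otimes> w \<otimes> (\<lblot>w, u\<rblot> [^] half \<otimes> \<lblot>w, v\<rblot> [^] half)"
    using M by (simp add: mult_baer commutator_mult_center c half_mult_right)
  have r: "u \<otimes>\<^bsub>baer\<^esub> (v \<otimes>\<^bsub>baer\<^esub> w) =
     u \<otimes> (v \<otimes> w \<otimes> \<lblot>w, v\<rblot> [^] half) \<otimes> (\<lblot>v, u\<rblot> [^] half \<otimes> \<lblot>w, u\<rblot> [^] half)"
    using M by (simp add: mult_baer commutator_mult_center c half_mult_left)
  show "(u \<otimes>\<^bsub>baer\<^esub> v) \<otimes>\<^bsub>baer\<^esub> w = u \<otimes>\<^bsub>baer\<^esub> (v \<otimes>\<^bsub>baer\<^esub> w)"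
    unfolding l r using M
    by (simp add: m_assoc center_lcommute[OF half_central[of v u], of w]
      center_lcommute[OF half_central[of w v], of "\<lblot>v, u\<rblot> [^] half"]
      center_commute[OF half_central[of w v], of "\<lblot>w, u\<rblot> [^] half"])
next
  show "u \<otimes>\<^bsub>baer\<^esub> v \<in> M" if "u \<in> M" "v \<in> M" for u v
    using that by (simp add: mult_baer)
  show "u \<otimes>\<^bsub>baer\<^esub> v = v \<otimes>\<^bsub>baer\<^esub> u" if "u \<in> M" "v \<in> M" for u v
    using that by (rule baer_comm)
  show "\<one> \<otimes>\<^bsub>baer\<^esub> u = u" if "u \<in> M" for u
    using that by (simp add: mult_baer)
  show "\<exists>v\<in>M. v \<otimes>\<^bsub>baer\<^esub> u = \<one>" if "u \<in> M" for u
    using that by (intro bexI[of _ "inv u"]) (simp_all add: mult_baer commutator_def)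
qed

end

sublocale p_central_metabelian_cover \<subseteq> L: comm_group baer
  rewrites "carrier baer = M" and "\<one>\<^bsub>baer\<^esub> = \<one>"
  by (simp_all add: comm_group_baer)

section \<open>Reindexing sums over residues modulo p\<close>

lemma (in comm_monoid) finprod_swap:
  assumes "\<And>i j. i \<in> A \<Longrightarrow> j \<in> B \<Longrightarrow> f i j \<in> carrier G" "finite A"
  shows "(\<Otimes>i\<in>A. \<Otimes>j\<in>B. f i j) = (\<Otimes>j\<in>B. \<Otimes>i\<in>A. f i j)"
  using assms(2,1)
proof (induction A rule: finite_induct)
  case (insert a A)
  have "(\<Otimes>j\<in>B. \<Otimes>i\<in>insert a A. f i j) = (\<Otimes>j\<in>B. f a j \<otimes> (\<Otimes>i\<in>A. f i j))"
    using insert by (intro finprod_cong') (auto simp: Pi_iff)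
  also have "\<dots> = (\<Otimes>j\<in>B. f a j) \<otimes> (\<Otimes>j\<in>B. \<Otimes>i\<in>A. f i j)"
    using insert by (intro finprod_multf) (auto simp: Pi_iff)
  finally show ?case using insert by (subst finprod_insert) (auto simp: Pi_iff)
qed simp

lemma bij_betw_affine_mod:
  assumes "coprime k n" "n > 0"
  shows "bij_betw (\<lambda>j. (k * j + s) mod n) {..<n} {..<n::nat}"
proof -
  have "inj_on (\<lambda>j. (k * j + s) mod n) {..<n}"
  proof (rule inj_onI)
    fix i j assume ij: "i \<in> {..<n}" "j \<in> {..<n}" "(k * i + s) mod n = (k * j + s) mod n"
    then have "[k * i = k * j] (mod n)"
      by (simp add: cong_add_rcancel_nat flip: cong_def)
    then have "[i = j] (mod n)" using assms cong_mult_lcancel_nat by blast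
    then show "i = j" using ij by (simp add: cong_def)
  qed
  moreover have "(\<lambda>j. (k * j + s) mod n) ` {..<n} \<subseteq> {..<n}" using assms by auto
  ultimately show ?thesis
    by (simp add: bij_betw_def endo_inj_surj)
qed

lemma periodic_mod:
  assumes "\<And>n::nat. f (n + p) = f n"
  shows "f (n mod p) = f n"
proof -
  have "f (m + k * p) = f m" for m k
  proof (induction k)
    case (Suc k)
    have "f (m + Suc k * p) = f (m + k * p + p)" by (simp add: algebra_simps)
    then show ?case using assms Suc by simp
  qed simp
  from this[of "n mod p" "n div p"] show ?thesis by simp
qed

text \<open>Exponents are natural numbers throughout; periodicity takes the place of reduction
  modulo p, after which an affine map with unit slope permutes the residues.\<close>

lemma (in comm_monoid) finprod_affine_periodic:
  assumes "\<And>n. f n \<in> carrier G" "\<And>n::nat. f (n + p) = f n" "coprime k p" "p > 0"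
  shows "(\<Otimes>j\<in>{..<p}. f (k * j + s)) = (\<Otimes>j\<in>{..<p}. f j)"
proof -
  have bij: "bij_betw (\<lambda>j. (k * j + s) mod p) {..<p} {..<p}"
    using assms by (intro bij_betw_affine_mod)
  have "(\<Otimes>j\<in>{..<p}. f (k * j + s)) = (\<Otimes>j\<in>{..<p}. f ((k * j + s) mod p))"
    using assms by (simp add: periodic_mod)
  also have "\<dots> = (\<Otimes>j\<in>(\<lambda>j. (k * j + s) mod p) ` {..<p}. f j)"
    using assms bij by (intro finprod_reindex[symmetric]) (auto simp: bij_betw_def)
  finally show ?thesis using bij by (simp add: bij_betw_def)
qed

context p_central_metabelian_cover
begin

abbreviation baer_mult (infixl "\<oplus>" 65) where "a \<oplus> b \<equiv> a \<otimes>\<^bsub>baer\<^esub> b"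

lemma baer_center:
  assumes "u \<in> M" "z \<in> M" "z \<in> center G"
  shows "u \<oplus> z = u \<otimes> z"
proof -
  have "\<lblot>z, u\<rblot> = \<one>" using assms by (simp add: commutator_eq_one_iff center_commute)
  then show ?thesis using assms by (simp add: mult_baer)
qed

lemma mult_eq_baer:
  assumes "u \<in> M" "v \<in> M"
  shows "u \<otimes> v = u \<oplus> v \<oplus> \<lblot>u, v\<rblot> [^] half"
proof -
  have "\<lblot>v, u\<rblot> [^] half = inv (\<lblot>u, v\<rblot> [^] half)"
    using assms by (simp add: nat_pow_inv flip: inv_commutator[of u v])
  then show ?thesis
    using assms by (simp add: baer_center half_central) (simp add: mult_baer m_assoc)
qed

text \<open>An element commutes with its own powers, so the corrections vanish. Hence statements
  about exponents mean the same in both groups.\<close>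

lemma baer_pow:
  assumes "u \<in> M"
  shows "u [^]\<^bsub>baer\<^esub> (n::nat) = u [^] n"
proof (induction n)
  case (Suc n)
  have "\<lblot>u, u [^] n\<rblot> = \<one>"
    using assms by (simp add: commutator_eq_one_iff nat_pow_Suc2[symmetric])
  then show ?case using Suc assms by (simp add: mult_baer)
qed simp

lemma M_finprod [simp]:
  assumes "\<And>i. i \<in> A \<Longrightarrow> f i \<in> M"
  shows "finprod baer f A \<in> M"
  using assms by (intro L.finprod_closed) auto

lemma baer_closed [simp]: "u \<in> M \<Longrightarrow> v \<in> M \<Longrightarrow> u \<oplus> v \<in> M"
  by (rule L.m_closed)

lemma finprod_hom:
  assumes "\<And>i. i \<in> A \<Longrightarrow> f i \<in> M"
    and "\<And>u. u \<in> M \<Longrightarrow> \<phi> u \<in> M" "\<phi> \<one> = \<one>"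
    and "\<And>u v. u \<in> M \<Longrightarrow> v \<in> M \<Longrightarrow> \<phi> (u \<oplus> v) = \<phi> u \<oplus> \<phi> v"
  shows "\<phi> (finprod baer f A) = finprod baer (\<lambda>i. \<phi> (f i)) A"
  using assms(1)
proof (induction A rule: infinite_finite_induct)
  case (insert a A)
  then show ?case using assms(2,4) by (simp add: Pi_iff)
qed (use assms(3) in simp_all)

lemma finprod_center:
  assumes "\<And>i. i \<in> A \<Longrightarrow> f i \<in> M" "\<And>i. i \<in> A \<Longrightarrow> f i \<in> center G"
  shows "finprod baer f A \<in> center G"
  using assms
proof (induction A rule: infinite_finite_induct)
  case (insert a A)
  then show ?case
    by (simp add: Pi_iff baer_center subgroup.m_closed[OF subgroup_center])
qed (use subgroup.one_closed[OF subgroup_center] in simp_all)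

text \<open>The Baer sum is a word in the group operations, and conjugation is an
  automorphism.\<close>

lemma conj_by_baer:
  assumes "u \<in> M" "v \<in> M" "g \<in> carrier G"
  shows "(u \<oplus> v) \<^bold>^ g = (u \<^bold>^ g) \<oplus> (v \<^bold>^ g)"
  using assms by (simp add: mult_baer conj_by_mult conj_by_pow conj_by_commutator)

lemma conj_by_finprod:
  assumes "\<And>i. i \<in> A \<Longrightarrow> f i \<in> M" "g \<in> carrier G"
  shows "finprod baer f A \<^bold>^ g = finprod baer (\<lambda>i. f i \<^bold>^ g) A"
  using assms by (intro finprod_hom[where \<phi> = "\<lambda>u. u \<^bold>^ g"]) (auto simp: conj_by_baer)

text \<open>Elements of \<open>M\<close> act on the Baer group by shears with central displacement;
  the errors of the collection process below arise from this.\<close>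

lemma conj_by_M:
  assumes "u \<in> M" "v \<in> M"
  shows "u \<^bold>^ v = u \<oplus> \<lblot>u, v\<rblot>"
  using assms by (simp add: conj_by_eq_mult_commutator baer_center M_commutator_central)

lemma commutator_baer_left:
  assumes "u \<in> M" "v \<in> M" "w \<in> M"
  shows "\<lblot>u \<oplus> v, w\<rblot> = \<lblot>u, w\<rblot> \<oplus> \<lblot>v, w\<rblot>"
  using assms by (simp add: mult_baer[of u v] commutator_mult_center half_central
    M_commutator_mult_left baer_center M_commutator_central)

lemma commutator_baer_right:
  assumes "u \<in> M" "v \<in> M" "w \<in> M"
  shows "\<lblot>u, v \<oplus> w\<rblot> = \<lblot>u, v\<rblot> \<oplus> \<lblot>u, w\<rblot>"
  using assms by (simp add: mult_baer[of v w] commutator_mult_center half_central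
    M_commutator_mult_right baer_center M_commutator_central)

lemma commutator_finprod_left:
  assumes "\<And>i. i \<in> A \<Longrightarrow> f i \<in> M" "w \<in> M"
  shows "\<lblot>finprod baer f A, w\<rblot> = finprod baer (\<lambda>i. \<lblot>f i, w\<rblot>) A"
  using assms by (intro finprod_hom[where \<phi> = "\<lambda>u. \<lblot>u, w\<rblot>"]) (auto simp: commutator_baer_left)

lemma commutator_finprod_right:
  assumes "\<And>i. i \<in> A \<Longrightarrow> f i \<in> M" "w \<in> M"
  shows "\<lblot>w, finprod baer f A\<rblot> = finprod baer (\<lambda>i. \<lblot>w, f i\<rblot>) A"
  using assms by (intro finprod_hom[where \<phi> = "\<lambda>u. \<lblot>w, u\<rblot>"]) (auto simp: commutator_baer_right)

lemma baer_pow_distrib: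
  assumes "u \<in> M" "v \<in> M"
  shows "(u \<oplus> v) [^] (n::nat) = u [^] n \<oplus> v [^] n"
  using L.nat_pow_distrib[of u v n] assms by (simp add: baer_pow)

lemma finprod_baer_pow:
  assumes "\<And>i. i \<in> A \<Longrightarrow> f i \<in> M"
  shows "finprod baer f A [^] (n::nat) = finprod baer (\<lambda>i. f i [^] n) A"
  using assms by (intro finprod_hom[where \<phi> = "\<lambda>u. u [^] n"]) (auto simp: baer_pow_distrib)

lemma inv_baer:
  assumes "u \<in> M"
  shows "inv\<^bsub>baer\<^esub> u = inv u"
  using assms by (intro L.inv_equality) (simp_all add: mult_baer commutator_def)

section \<open>Sums over the lines of a plane\<close>

text \<open>The autocorrelation of c under translation by g, for the commutator pairing on
  \<open>M\<close>.\<close>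

definition bform :: "'a \<Rightarrow> 'a \<Rightarrow> 'a" where
  "bform c g = \<lblot>c, c \<^bold>^ g\<rblot>"

text \<open>Additively, this is the norm element 1 + g + ... + g^(p-1) of the group ring, applied to
  c.\<close>

definition norm :: "'a \<Rightarrow> 'a \<Rightarrow> 'a" where
  "norm c g = finprod baer (\<lambda>r. c \<^bold>^ (g [^] r)) {..<p}"

text \<open>The first moment of the autocorrelation along the line of g. The weights come from the
  number of pairs of conjugates at distance u in the ordered product [x, g^p], which is p - u, that
  is, -u modulo p.\<close>

definition moment :: "'a \<Rightarrow> 'a \<Rightarrow> 'a" where
  "moment c g = finprod baer (\<lambda>u. bform c (g [^] u) [^] u) {..<p}"

lemma bform_M [simp]: "c \<in> M \<Longrightarrow> g \<in> carrier G \<Longrightarrow> bform c g \<in> M"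
  by (simp add: bform_def)

lemma bform_central: "c \<in> M \<Longrightarrow> g \<in> carrier G \<Longrightarrow> bform c g \<in> center G"
  by (simp add: bform_def M_commutator_central)

lemma bform_one [simp]: "c \<in> M \<Longrightarrow> bform c \<one> = \<one>"
  by (simp add: bform_def)

lemma bform_pow_p: "c \<in> M \<Longrightarrow> g \<in> carrier G \<Longrightarrow> bform c g [^] p = \<one>"
  by (simp add: bform_def)

text \<open>The factor d changes the conjugate of c by a commutator of elements of \<open>M\<close>,
  which is central and invisible to the outer commutator.\<close>

lemma bform_mult_M:
  assumes "c \<in> M" "g \<in> carrier G" "d \<in> M"
  shows "bform c (g \<otimes> d) = bform c g"
proof -
  have "c \<^bold>^ (g \<otimes> d) = (c \<^bold>^ g) \<otimes> \<lblot>c \<^bold>^ g, d\<rblot>"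
    using assms by (simp flip: conj_by_conj_by conj_by_eq_mult_commutator)
  then show ?thesis
    using assms by (simp add: bform_def commutator_mult_center M_commutator_central)
qed

lemma bform_mult_commute:
  assumes "c \<in> M" "g \<in> carrier G" "h \<in> carrier G"
  shows "bform c (g \<otimes> h) = bform c (h \<otimes> g)"
  using assms commutator_swap[of g h] by (simp add: bform_mult_M)

lemma commutator_inv_inv:
  assumes "u \<in> M" "v \<in> M"
  shows "\<lblot>inv u, inv v\<rblot> = \<lblot>u, v\<rblot>"
proof -
  have "\<lblot>inv u, w\<rblot> \<otimes> \<lblot>u, w\<rblot> = \<one>" if "w \<in> M" for w
    using assms that by (simp flip: M_commutator_mult_left)
  moreover have "\<lblot>u, inv v\<rblot> \<otimes> \<lblot>u, v\<rblot> = \<one>"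
    using assms by (simp flip: M_commutator_mult_right)
  ultimately have "inv \<lblot>u, v\<rblot> = \<lblot>u, inv v\<rblot>" "inv \<lblot>u, inv v\<rblot> = \<lblot>inv u, inv v\<rblot>"
    using assms by (simp_all add: inv_equality)
  then show ?thesis using assms by (metis inv_inv M_carrier commutator_closed)
qed

text \<open>The form is quadratic in c, so signs cancel. This matters because the pairs (y, y^j x)
  have commutator \<open>inv c\<close> and yet must yield moments of c.\<close>

lemma bform_inv:
  assumes "c \<in> M" "g \<in> carrier G"
  shows "bform (inv c) g = bform c g"
  using assms by (simp add: bform_def conj_by_inv commutator_inv_inv)

lemma moment_inv: "c \<in> M \<Longrightarrow> g \<in> carrier G \<Longrightarrow> moment (inv c) g = moment c g"
  by (simp add: moment_def bform_inv)

lemma moment_M [simp]: "c \<in> M \<Longrightarrow> g \<in> carrier G \<Longrightarrow> moment c g \<in> M"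
  by (simp add: moment_def)

lemma moment_central: "c \<in> M \<Longrightarrow> g \<in> carrier G \<Longrightarrow> moment c g \<in> center G"
  unfolding moment_def by (intro finprod_center center_pow bform_central) auto

lemma moment_pow_p:
  assumes "c \<in> M" "g \<in> carrier G" shows "moment c g [^] p = \<one>"
proof -
  have "(bform c (g [^] u) [^] u) [^] p = \<one>" for u :: nat
    using assms by (simp add: nat_pow_pow mult.commute[of u p])
      (simp add: bform_pow_p flip: nat_pow_pow[of _ p u])
  then show ?thesis
    using assms by (simp add: moment_def finprod_baer_pow)
qed

lemma norm_M [simp]: "c \<in> M \<Longrightarrow> g \<in> carrier G \<Longrightarrow> norm c g \<in> M"
  by (simp add: norm_def)

lemma finprod_inv:
  assumes "\<And>i. i \<in> A \<Longrightarrow> f i \<in> M"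
  shows "finprod baer (\<lambda>i. inv (f i)) A = inv (finprod baer f A)"
proof -
  have "inv (u \<oplus> v) = inv u \<oplus> inv v" if "u \<in> M" "v \<in> M" for u v
    using that L.inv_mult[of u v] by (simp add: inv_baer)
  then show ?thesis
    using assms by (intro finprod_hom[where \<phi> = "\<lambda>u. inv u", symmetric]) auto
qed

lemma norm_inv: "c \<in> M \<Longrightarrow> g \<in> carrier G \<Longrightarrow> norm (inv c) g = inv (norm c g)"
  by (simp add: norm_def conj_by_inv finprod_inv)

text \<open>In \<open>G\<close>, the commutator \<open>[x, y\<^sup>n]\<close> is the ordered product of the conjugates of \<open>c\<close> by
  \<open>1, y, \<dots>, y\<^sup>n\<^sup>-\<^sup>1\<close>; the second summand collects the commutators between these conjugates.\<close>

lemma commutator_pow_right_baer: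
  assumes xy: "x \<in> carrier G" "y \<in> carrier G" and c: "c = \<lblot>x, y\<rblot>"
  shows "\<lblot>x, y [^] (n::nat)\<rblot> = finprod baer (\<lambda>r. c \<^bold>^ (y [^] r)) {..<n} \<oplus>
     finprod baer (\<lambda>u. bform c (y [^] u) [^] (n - u)) {..<n} [^] half"
    (is "_ = ?S n \<oplus> ?W n [^] half")
proof (induction n)
  case (Suc n)
  have cM: "c \<in> M" using xy c by simp
  have M: "?S m \<in> M" "?W m \<in> M" for m using cM xy by auto
  have W: "?W m \<in> center G" for m
    using cM xy by (intro finprod_center center_pow bform_central) auto
  let ?B = "finprod baer (\<lambda>u. bform c (y [^] u)) {..<Suc n}"
  have B: "?B \<in> M" using cM xy by simp
  \<comment> \<open>Conjugation by y^r fixes the central value, so only the distance n - r of two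
    conjugates matters.\<close>
  have "\<lblot>c \<^bold>^ (y [^] r), c \<^bold>^ (y [^] n)\<rblot> = bform c (y [^] (n - r))" if "r < n" for r
  proof -
    have "c \<^bold>^ (y [^] n) = c \<^bold>^ (y [^] (n - r)) \<^bold>^ (y [^] r)"
      using that cM xy by (simp add: conj_by_conj_by nat_pow_mult)
    then have "\<lblot>c \<^bold>^ (y [^] r), c \<^bold>^ (y [^] n)\<rblot> = bform c (y [^] (n - r)) \<^bold>^ (y [^] r)"
      using cM xy by (simp add: bform_def conj_by_commutator)
    then show ?thesis using cM xy by (simp add: conj_by_center bform_central)
  qed
  then have "\<lblot>?S n, c \<^bold>^ (y [^] n)\<rblot> = finprod baer (\<lambda>r. bform c (y [^] (n - r))) {..<n}"
    using cM xy by (subst commutator_finprod_left) (auto intro!: L.finprod_cong')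
  also have "\<dots> = finprod baer (\<lambda>u. bform c (y [^] u)) ((\<lambda>r. n - r) ` {..<n})"
    using cM xy by (intro L.finprod_reindex[symmetric]) (auto intro!: inj_onI)
  also have "(\<lambda>r. n - r) ` {..<n} = {1..n}"
  proof (intro equalityI subsetI)
    fix u assume "u \<in> {1..n}"
    then have "u = n - (n - u)" "n - u \<in> {..<n}" by auto
    then show "u \<in> (\<lambda>r. n - r) ` {..<n}" by (rule image_eqI)
  qed auto
  \<comment> \<open>The term u = 0 is trivial; including it gives the range of ?W (Suc n).\<close>
  also have "finprod baer (\<lambda>u. bform c (y [^] u)) {1..n} = ?B"
    using cM xy by (intro L.finprod_mono_neutral_cong_left) (auto simp: Pi_iff not_less_eq_eq)
  finally have comm: "\<lblot>?S n, c \<^bold>^ (y [^] n)\<rblot> = ?B" .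
  have "?W (Suc n) = finprod baer (\<lambda>u. bform c (y [^] u) [^] (n - u) \<oplus> bform c (y [^] u)) {..<Suc n}"
  proof (intro L.finprod_cong')
    fix u assume "u \<in> {..<Suc n}"
    then have "Suc n - u = Suc (n - u)" by auto
    then show "bform c (y [^] u) [^] (Suc n - u) = bform c (y [^] u) [^] (n - u) \<oplus> bform c (y [^] u)"
      using cM xy by (simp add: baer_center bform_central)
  qed (use cM xy in auto)
  also have "\<dots> = finprod baer (\<lambda>u. bform c (y [^] u) [^] (n - u)) {..<Suc n} \<oplus> ?B"
    using cM xy by (intro L.finprod_multf) auto
  also have "finprod baer (\<lambda>u. bform c (y [^] u) [^] (n - u)) {..<Suc n} = ?W n"
    using cM xy by (subst lessThan_Suc, subst L.finprod_insert) auto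
  finally have WS: "?W (Suc n) = ?W n \<oplus> ?B" .
  have SS: "?S (Suc n) = ?S n \<oplus> c \<^bold>^ (y [^] n)"
    using cM xy by (subst lessThan_Suc, subst L.finprod_insert) (auto simp: L.m_comm)
  have "\<lblot>x, y [^] Suc n\<rblot> = \<lblot>x, y [^] n\<rblot> \<otimes> c \<^bold>^ (y [^] n)"
    using xy c by (simp only: nat_pow_Suc2[OF xy(2)]) (simp add: commutator_mult_right)
  also have "\<dots> = \<lblot>x, y [^] n\<rblot> \<oplus> c \<^bold>^ (y [^] n) \<oplus> \<lblot>\<lblot>x, y [^] n\<rblot>, c \<^bold>^ (y [^] n)\<rblot> [^] half"
    using xy cM by (intro mult_eq_baer) auto
  also have "\<lblot>\<lblot>x, y [^] n\<rblot>, c \<^bold>^ (y [^] n)\<rblot> = ?B"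
  proof -
    have "\<lblot>?W n [^] half, c \<^bold>^ (y [^] n)\<rblot> = \<one>"
      using cM xy M center_commute[OF center_pow[OF W[of n], of half], of "c \<^bold>^ (y [^] n)"]
      by (subst commutator_eq_one_iff) auto
    then show ?thesis using M cM xy by (simp add: Suc commutator_baer_left comm)
  qed
  finally have "\<lblot>x, y [^] Suc n\<rblot> = (?S n \<oplus> ?W n [^] half) \<oplus> c \<^bold>^ (y [^] n) \<oplus> ?B [^] half"
    by (simp add: Suc)
  also have "\<dots> = (?S n \<oplus> c \<^bold>^ (y [^] n)) \<oplus> (?W n [^] half \<oplus> ?B [^] half)"
    using M B cM xy by (simp add: L.m_ac)
  also have "\<dots> = ?S (Suc n) \<oplus> ?W (Suc n) [^] half"
    using M B by (simp only: SS WS baer_pow_distrib)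
  finally show ?case .
qed (use xy in simp)

text \<open>This is the case n = p of the formula for [x, y^n]. Values of \<open>bform\<close> have
  order dividing p, so the weight p - u acts as -u and the correction is minus half the
  moment.\<close>

lemma norm_eq:
  assumes xy: "x \<in> carrier G" "y \<in> carrier G" and c: "c = \<lblot>x, y\<rblot>"
  shows "norm c y = \<lblot>x, y [^] p\<rblot> \<oplus> moment c y [^] half"
proof -
  have cM: "c \<in> M" using xy c by simp
  let ?W = "finprod baer (\<lambda>u. bform c (y [^] u) [^] (p - u)) {..<p}"
  have W: "?W \<in> M" using cM xy by simp
  have "?W \<oplus> moment c y = finprod baer (\<lambda>u. bform c (y [^] u) [^] (p - u) \<oplus> bform c (y [^] u) [^] u) {..<p}"
    unfolding moment_def using cM xy by (intro L.finprod_multf[symmetric]) auto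
  also have "\<dots> = finprod baer (\<lambda>u. \<one>) {..<p}"
    using cM xy by (intro L.finprod_cong')
      (auto simp: baer_center bform_central center_pow nat_pow_mult bform_pow_p)
  finally have "(?W \<oplus> moment c y) [^] half = \<one>" by simp
  then have *: "?W [^] half \<oplus> moment c y [^] half = \<one>"
    using W cM xy by (simp add: baer_pow_distrib)
  have "\<lblot>x, y [^] p\<rblot> \<oplus> moment c y [^] half = norm c y \<oplus> (?W [^] half \<oplus> moment c y [^] half)"
    using commutator_pow_right_baer[OF xy c, of p] W cM xy
    by (simp add: L.m_assoc flip: norm_def)
  then show ?thesis using * cM xy by simp
qed

lemma commutator_pow_p_central': "x \<in> carrier G \<Longrightarrow> y \<in> carrier G \<Longrightarrow> \<lblot>x, y [^] p\<rblot> \<in> center G"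
  using subgroup.m_inv_closed[OF subgroup_center commutator_pow_p_central[of y x]]
  by (simp add: inv_commutator)

text \<open>Both summands in \<open>norm_eq\<close> are central. Consequently conjugation fixes this
  norm and its commutators vanish.\<close>

lemma norm_central:
  assumes xy: "x \<in> carrier G" "y \<in> carrier G"
  shows "norm \<lblot>x, y\<rblot> y \<in> center G"
  using xy by (simp add: norm_eq[OF xy] baer_center center_pow moment_central
    subgroup.m_closed[OF subgroup_center] commutator_pow_p_central')

end

text \<open>The quotient by the derived subgroup is commutative. The factor d is kept explicit
  because \<open>bform\<close> discards it.\<close>

lemma (in group) pow_mult_in_derived_coset:
  assumes "a \<in> carrier G" "b \<in> carrier G"
  shows "\<exists>d\<in>derived G (carrier G). (a \<otimes> b) [^] (n::nat) = a [^] n \<otimes> b [^] n \<otimes> d"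
proof (induction n)
  case 0
  then show ?case
    using subgroup.one_closed[OF derived_is_subgroup[of "carrier G"]] by force
next
  case (Suc n)
  let ?D = "derived G (carrier G)"
  interpret D: subgroup ?D G by (simp add: derived_is_subgroup)
  have conj: "u \<^bold>^ g \<in> ?D" if "u \<in> ?D" "g \<in> carrier G" for u g
    using that D.mem_carrier by (simp add: conj_by_eq_mult_commutator commutator_in_derived)
  from Suc obtain d where d: "d \<in> ?D" "(a \<otimes> b) [^] n = a [^] n \<otimes> b [^] n \<otimes> d" by auto
  have "(a \<otimes> b) [^] Suc n =
      a [^] Suc n \<otimes> b [^] Suc n \<otimes> ((\<lblot>b [^] n, a\<rblot> \<^bold>^ b) \<otimes> (d \<^bold>^ (a \<otimes> b)))"
    using assms d D.mem_carrier by (simp add: word_simps)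
  moreover have "(\<lblot>b [^] n, a\<rblot> \<^bold>^ b) \<otimes> (d \<^bold>^ (a \<otimes> b)) \<in> ?D"
    using assms d by (intro D.m_closed conj) (auto simp: commutator_in_derived)
  ultimately show ?case by blast
qed

section \<open>Collecting powers of products inside sums of conjugates\<close>

context p_central_metabelian_cover
begin

text \<open>Put c = [x, y] and f = [y, b]. Up to order, [y^j, b] is the product of the conjugates of
  f by y^i for i < j, and [x, y^N] that of the conjugates of c by y^m for m < N. Conjugation fixes
  the central commutators, so powers of y move from f to c and the first term is a difference of two
  values of [[x, y^N], f].\<close>

lemma commutator_conj_pow:
  fixes n j :: nat
  assumes xyb: "x \<in> carrier G" "y \<in> carrier G" "b \<in> carrier G"
  shows "\<lblot>\<lblot>x, y\<rblot> \<^bold>^ (y [^] (n + j)), \<lblot>y [^] j, b\<rblot>\<rblot> \<oplus> \<lblot>\<lblot>x, y [^] (n + 1)\<rblot>, \<lblot>y, b\<rblot>\<rblot>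
    = \<lblot>\<lblot>x, y [^] (n + 1 + j)\<rblot>, \<lblot>y, b\<rblot>\<rblot>"
proof (induction j)
  case (Suc j)
  let ?c = "\<lblot>x, y\<rblot>" and ?f = "\<lblot>y, b\<rblot>"
  have "\<lblot>?c \<^bold>^ (y [^] (n + Suc j)), \<lblot>y [^] Suc j, b\<rblot>\<rblot>
      = \<lblot>?c \<^bold>^ (y [^] (n + j)) \<^bold>^ y, (\<lblot>y [^] j, b\<rblot> \<^bold>^ y) \<otimes> ?f\<rblot>"
    using xyb by (simp add: commutator_mult_left conj_by_conj_by)
  also have "\<dots> = (\<lblot>?c \<^bold>^ (y [^] (n + j)), \<lblot>y [^] j, b\<rblot>\<rblot> \<^bold>^ y) \<oplus> \<lblot>?c \<^bold>^ (y [^] (n + Suc j)), ?f\<rblot>"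
    using xyb by (simp add: M_commutator_mult_right conj_by_commutator baer_center
        M_commutator_central conj_by_conj_by)
  also have "\<lblot>?c \<^bold>^ (y [^] (n + j)), \<lblot>y [^] j, b\<rblot>\<rblot> \<^bold>^ y = \<lblot>?c \<^bold>^ (y [^] (n + j)), \<lblot>y [^] j, b\<rblot>\<rblot>"
    using xyb by (intro conj_by_center M_commutator_central) auto
  finally have 1: "\<lblot>?c \<^bold>^ (y [^] (n + Suc j)), \<lblot>y [^] Suc j, b\<rblot>\<rblot> =
     \<lblot>?c \<^bold>^ (y [^] (n + j)), \<lblot>y [^] j, b\<rblot>\<rblot> \<oplus> \<lblot>?c \<^bold>^ (y [^] (n + Suc j)), ?f\<rblot>" .
  have "\<lblot>x, y [^] (n + 1 + Suc j)\<rblot> = \<lblot>x, y [^] (n + 1 + j)\<rblot> \<otimes> ?c \<^bold>^ (y [^] (n + 1 + j))"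
    using xyb nat_pow_Suc2[OF xyb(2), of "n + 1 + j"] by (simp add: commutator_mult_right del: nat_pow_Suc)
  then have 2: "\<lblot>\<lblot>x, y [^] (n + 1 + Suc j)\<rblot>, ?f\<rblot> =
     \<lblot>\<lblot>x, y [^] (n + 1 + j)\<rblot>, ?f\<rblot> \<oplus> \<lblot>?c \<^bold>^ (y [^] (n + Suc j)), ?f\<rblot>"
    using xyb by (simp add: M_commutator_mult_left baer_center M_commutator_central del: nat_pow_Suc)
  show ?case
    unfolding 2 Suc[symmetric] unfolding 1 using xyb by (simp add: L.m_ac del: nat_pow_Suc)
qed (use xyb in simp)

text \<open>The extra factor y^p contributes only the central commutator [x, y^p].\<close>

lemma commutator_pow_periodic:
  assumes "x \<in> carrier G" "y \<in> carrier G" "f \<in> M"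
  shows "\<lblot>\<lblot>x, y [^] (n + p)\<rblot>, f\<rblot> = \<lblot>\<lblot>x, y [^] (n::nat)\<rblot>, f\<rblot>"
proof -
  have "\<lblot>x, y [^] (n + p)\<rblot> = \<lblot>x, y [^] p \<otimes> y [^] n\<rblot>"
    using assms by (simp add: nat_pow_mult add.commute)
  also have "\<dots> = \<lblot>x, y [^] n\<rblot> \<otimes> \<lblot>x, y [^] p\<rblot>"
    using assms by (simp add: commutator_mult_right conj_by_center commutator_pow_p_central')
  finally show ?thesis
    using assms by (simp add: commutator_mult_center commutator_pow_p_central')
qed

text \<open>Moving y^j to the left across x^k changes the j-th summand by a central F j, equal to
  H((k+1)j + 1) minus H(kj + 1) for a function H of period p. Since k and k + 1 are units modulo p,
  both index maps permute the residues, so the errors cancel in the sum though not termwise.\<close>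

lemma sum_conj_swap:
  assumes xy: "x \<in> carrier G" "y \<in> carrier G" and c: "c = \<lblot>x, y\<rblot>"
    and r: "\<And>j. r j \<in> carrier G" and k: "coprime k p" "coprime (Suc k) p"
  shows "finprod baer (\<lambda>j. c \<^bold>^ (y [^] (k * j) \<otimes> x [^] k \<otimes> y [^] j \<otimes> r j)) {..<p}
    = finprod baer (\<lambda>j. c \<^bold>^ (y [^] (Suc k * j) \<otimes> x [^] k \<otimes> r j)) {..<p}"
proof -
  have cM: "c \<in> M" using xy c by simp
  \<comment> \<open>Conjugation by x^-k strips x^k from u j and turns [x^k, y^j] into [y^j, x^-k],
    the shape handled by \<open>commutator_conj_pow\<close>.\<close>
  let ?b = "inv (x [^] k)"
  let ?f = "\<lblot>y, ?b\<rblot>"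
  define u where "u j = c \<^bold>^ (y [^] (Suc k * j) \<otimes> x [^] k)" for j
  have uM [simp]: "u j \<in> M" for j using cM xy by (simp add: u_def)
  define F where "F j = \<lblot>u j, \<lblot>x [^] k, y [^] j\<rblot>\<rblot>" for j
  have F [simp]: "F j \<in> M" "F j \<in> center G" for j
    using xy by (auto simp: F_def M_commutator_central)
  define H where "H n = \<lblot>\<lblot>x, y [^] (n::nat)\<rblot>, ?f\<rblot>" for n
  have H: "H n \<in> M" for n using xy by (simp add: H_def)
  have 1: "c \<^bold>^ (y [^] (k * j) \<otimes> x [^] k \<otimes> y [^] j \<otimes> r j) = c \<^bold>^ (y [^] (Suc k * j) \<otimes> x [^] k \<otimes> r j) \<oplus> F j" for j
  proof -
    have "y [^] (k * j) \<otimes> x [^] k \<otimes> y [^] j = y [^] (k * j) \<otimes> (y [^] j \<otimes> x [^] k \<otimes> \<lblot>x [^] k, y [^] j\<rblot>)"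
      using xy commutator_swap[of "x [^] k" "y [^] j"] by (simp add: m_assoc)
    also have "\<dots> = y [^] (Suc k * j) \<otimes> x [^] k \<otimes> \<lblot>x [^] k, y [^] j\<rblot>"
      using xy by (simp add: nat_pow_mult add.commute flip: m_assoc)
    finally have "c \<^bold>^ (y [^] (k * j) \<otimes> x [^] k \<otimes> y [^] j \<otimes> r j) = u j \<^bold>^ \<lblot>x [^] k, y [^] j\<rblot> \<^bold>^ r j"
      using xy cM r by (simp add: u_def conj_by_conj_by)
    also have "\<dots> = (u j \<oplus> F j) \<^bold>^ r j"
      using xy by (simp add: conj_by_M F_def)
    also have "\<dots> = (u j \<^bold>^ r j) \<oplus> F j"
      using r by (simp add: conj_by_baer conj_by_center)
    finally show ?thesis using xy cM r by (simp add: u_def conj_by_conj_by)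
  qed
  have 2: "F j \<oplus> H (k * j + 1) = H (Suc k * j + 1)" for j
  proof -
    have "F j = F j \<^bold>^ ?b" using xy by (simp add: conj_by_center)
    also have "\<dots> = \<lblot>u j \<^bold>^ ?b, \<lblot>x [^] k, y [^] j\<rblot> \<^bold>^ ?b\<rblot>"
      using xy by (simp add: F_def conj_by_commutator)
    also have "u j \<^bold>^ ?b = c \<^bold>^ (y [^] (k * j + j))"
      using xy cM by (simp add: u_def conj_by_conj_by m_assoc add.commute)
    also have "\<lblot>x [^] k, y [^] j\<rblot> \<^bold>^ ?b = \<lblot>y [^] j, ?b\<rblot>"
      using xy by (simp add: word_simps)
    finally show ?thesis
      using commutator_conj_pow[OF xy, of ?b "k * j" j] xy c by (simp add: H_def algebra_simps)
  qed
  have per: "finprod baer (\<lambda>j. H (l * j + 1)) {..<p} = finprod baer H {..<p}" if "coprime l p" for l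
  proof (rule L.finprod_affine_periodic)
    show "H (n + p) = H n" for n using xy by (simp add: H_def commutator_pow_periodic)
  qed (use that H p_pos in auto)
  have "finprod baer F {..<p} \<oplus> finprod baer (\<lambda>j. H (k * j + 1)) {..<p}
      = finprod baer (\<lambda>j. H (Suc k * j + 1)) {..<p}"
    unfolding 2[symmetric] using H by (intro L.finprod_multf[symmetric]) auto
  then have "finprod baer F {..<p} \<oplus> finprod baer H {..<p} = finprod baer H {..<p}"
    by (simp only: per k)
  then have F1: "finprod baer F {..<p} = \<one>" using H by simp
  have "finprod baer (\<lambda>j. c \<^bold>^ (y [^] (k * j) \<otimes> x [^] k \<otimes> y [^] j \<otimes> r j)) {..<p}
      = finprod baer (\<lambda>j. c \<^bold>^ (y [^] (Suc k * j) \<otimes> x [^] k \<otimes> r j)) {..<p} \<oplus> finprod baer F {..<p}"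
    unfolding 1 using cM xy r by (intro L.finprod_multf) auto
  then show ?thesis using F1 cM xy r by simp
qed

lemma coprime_p: "0 < k \<Longrightarrow> k < p \<Longrightarrow> coprime k p"
  using prime_p by (metis coprime_commute nat_dvd_not_less prime_imp_coprime)

text \<open>Each swap absorbs one factor y^j x into the collected part. The bound k + m < p keeps
  all exponents from k to k + m prime to p.\<close>

lemma sum_conj_collect:
  assumes xy: "x \<in> carrier G" "y \<in> carrier G" and c: "c = \<lblot>x, y\<rblot>"
    and k: "0 < k" "k + m < p"
  shows "finprod baer (\<lambda>j. c \<^bold>^ (y [^] (k * j) \<otimes> x [^] k \<otimes> (y [^] j \<otimes> x) [^] m)) {..<p}
    = finprod baer (\<lambda>j. c \<^bold>^ (y [^] ((k + m) * j) \<otimes> x [^] (k + m))) {..<p}"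
  using k
proof (induction m arbitrary: k)
  case 0
  then show ?case using xy by simp
next
  case (Suc m)
  have "y [^] (k * j) \<otimes> x [^] k \<otimes> (y [^] j \<otimes> x) [^] Suc m =
     y [^] (k * j) \<otimes> x [^] k \<otimes> y [^] j \<otimes> (x \<otimes> (y [^] j \<otimes> x) [^] m)" for j
    using xy nat_pow_Suc2[of "y [^] j \<otimes> x" m] by (simp add: m_assoc)
  moreover have "y [^] (Suc k * j) \<otimes> x [^] k \<otimes> (x \<otimes> (y [^] j \<otimes> x) [^] m) =
     y [^] (Suc k * j) \<otimes> x [^] Suc k \<otimes> (y [^] j \<otimes> x) [^] m" for j
    using xy by (simp add: m_assoc)
  ultimately show ?case
    using sum_conj_swap[OF xy c, of "\<lambda>j. x \<otimes> (y [^] j \<otimes> x) [^] m" k] Suc.IH[of "Suc k"] Suc.prems xy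
    by (simp add: coprime_p del: nat_pow_Suc)
qed

text \<open>In the plane, the points (y^j x)^i with i fixed form the line through x^i parallel to y.
  Its sum is a conjugate of \<open>norm c y\<close>, which is central.\<close>

lemma sum_conj_pow:
  assumes xy: "x \<in> carrier G" "y \<in> carrier G" and c: "c = \<lblot>x, y\<rblot>" and i: "0 < i" "i < p"
  shows "finprod baer (\<lambda>j. c \<^bold>^ ((y [^] j \<otimes> x) [^] i)) {..<p} = norm c y"
proof -
  have cM: "c \<in> M" using xy c by simp
  from i obtain m where m: "i = Suc m" using gr0_conv_Suc by blast
  have "finprod baer (\<lambda>j. c \<^bold>^ ((y [^] j \<otimes> x) [^] i)) {..<p}
      = finprod baer (\<lambda>j. c \<^bold>^ (y [^] (i * j) \<otimes> x [^] i)) {..<p}"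
  proof -
    have "(y [^] j \<otimes> x) [^] i = y [^] (1 * j) \<otimes> x [^] (1::nat) \<otimes> (y [^] j \<otimes> x) [^] m" for j :: nat
      using xy nat_pow_Suc2[of "y [^] j \<otimes> x" m] by (simp add: m del: nat_pow_Suc)
    then show ?thesis
      using sum_conj_collect[OF xy c, of 1 m] i m by simp
  qed
  also have "\<dots> = finprod baer (\<lambda>j. c \<^bold>^ (y [^] (i * j))) {..<p} \<^bold>^ (x [^] i)"
    using cM xy by (subst conj_by_finprod) (auto simp: conj_by_conj_by)
  also have "finprod baer (\<lambda>j. c \<^bold>^ (y [^] (i * j))) {..<p} = norm c y"
  proof -
    have "c \<^bold>^ (y [^] (n + p)) = c \<^bold>^ (y [^] n)" for n
      using cM xy conj_by_pow_p[of y "c \<^bold>^ (y [^] n)"]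
      by (simp add: conj_by_conj_by nat_pow_mult del: conj_by_pow_p)
    then show ?thesis
      using L.finprod_affine_periodic[of "\<lambda>n. c \<^bold>^ (y [^] n)" p i 0] cM xy i p_pos
      by (simp add: norm_def coprime_p)
  qed
  also have "norm c y \<^bold>^ (x [^] i) = norm c y"
    using xy norm_central[OF xy] by (simp add: c conj_by_center)
  finally show ?thesis .
qed

end

text \<open>All pairs (y, y^j x) therefore share one commutator, so one element c serves all
  lines.\<close>

lemma (in group) commutator_mult_own_pow:
  assumes "x \<in> carrier G" "y \<in> carrier G"
  shows "\<lblot>y, y [^] (n::nat) \<otimes> x\<rblot> = \<lblot>y, x\<rblot>"
proof -
  have "\<lblot>y, y [^] n\<rblot> = \<one>"
    using assms by (simp add: commutator_eq_one_iff nat_pow_Suc2[symmetric])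
  then show ?thesis using assms by (simp add: commutator_mult_right)
qed

section \<open>Moments along the lines of the plane\<close>

context p_central_metabelian_cover
begin

text \<open>Bilinearity turns the sum into [c, \<open>norm c y\<close>], and this norm is
  central.\<close>

lemma sum_bform_pow:
  assumes xy: "x \<in> carrier G" "y \<in> carrier G" and c: "c = \<lblot>x, y\<rblot>" and u: "0 < u" "u < p"
  shows "finprod baer (\<lambda>j. bform c ((y [^] j \<otimes> x) [^] u)) {..<p} = \<one>"
proof -
  have cM: "c \<in> M" using xy c by simp
  have "finprod baer (\<lambda>j. bform c ((y [^] j \<otimes> x) [^] u)) {..<p} = \<lblot>c, norm c y\<rblot>"
    unfolding bform_def sum_conj_pow[OF xy c u, symmetric] using cM xy
    by (intro commutator_finprod_right[symmetric]) auto
  also have "\<dots> = \<one>"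
    using cM xy norm_central[OF xy] by (simp add: commutator_eq_one_iff center_commute c)
  finally show ?thesis .
qed

text \<open>The weight u does not depend on j, so after interchanging the sums every inner sum is
  trivial; the weight itself disposes of u = 0.\<close>

lemma sum_moment:
  assumes xy: "x \<in> carrier G" "y \<in> carrier G" and c: "c = \<lblot>x, y\<rblot>"
  shows "finprod baer (\<lambda>j. moment c (y [^] j \<otimes> x)) {..<p} = \<one>"
proof -
  have cM: "c \<in> M" using xy c by simp
  have "finprod baer (\<lambda>j. moment c (y [^] j \<otimes> x)) {..<p}
     = finprod baer (\<lambda>u. finprod baer (\<lambda>j. bform c ((y [^] j \<otimes> x) [^] u) [^] u) {..<p}) {..<p}"
    unfolding moment_def using cM xy by (intro L.finprod_swap) auto
  also have "\<dots> = finprod baer (\<lambda>u. finprod baer (\<lambda>j. bform c ((y [^] j \<otimes> x) [^] u)) {..<p} [^] u) {..<p}"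
    using cM xy by (simp add: finprod_baer_pow)
  also have "\<dots> = \<one>"
  proof (rule L.finprod_one_eqI)
    fix u assume "u \<in> {..<p}"
    then show "finprod baer (\<lambda>j. bform c ((y [^] j \<otimes> x) [^] u)) {..<p} [^] u = \<one>"
      using sum_bform_pow[OF xy c, of u] by (cases "u = 0") simp_all
  qed
  finally show ?thesis .
qed

lemma lessThan_p: "{..<p} = insert 0 {1..<p}"
  using p_pos by auto

text \<open>The cosets \<open>y\<^sup>jx\<close> and \<open>y\<close> represent the lines of the plane spanned by \<open>x\<close> and \<open>y\<close> over
  the field with \<open>p\<close> elements, and every nonzero vector lies on exactly one line.\<close>

lemma sum_norm:
  assumes xy: "x \<in> carrier G" "y \<in> carrier G" and c: "c = \<lblot>x, y\<rblot>"
  shows "finprod baer (\<lambda>j. norm c (y [^] j \<otimes> x)) {..<p} = c [^] p \<oplus> norm c y [^] (p - 1)"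
proof -
  have cM: "c \<in> M" using xy c by simp
  have "finprod baer (\<lambda>j. norm c (y [^] j \<otimes> x)) {..<p}
      = finprod baer (\<lambda>i. finprod baer (\<lambda>j. c \<^bold>^ ((y [^] j \<otimes> x) [^] i)) {..<p}) {..<p}"
    unfolding norm_def using cM xy by (intro L.finprod_swap) auto
  \<comment> \<open>The index i = 0 is the zero vector, met once on each of the p lines; it supplies
    the p copies of c.\<close>
  also have "\<dots> = finprod baer (\<lambda>j. c) {..<p} \<oplus>
      finprod baer (\<lambda>i. finprod baer (\<lambda>j. c \<^bold>^ ((y [^] j \<otimes> x) [^] i)) {..<p}) {1..<p}"
    using cM xy by (subst (2) lessThan_p, subst L.finprod_insert) auto
  also have "finprod baer (\<lambda>i. finprod baer (\<lambda>j. c \<^bold>^ ((y [^] j \<otimes> x) [^] i)) {..<p}) {1..<p}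
      = finprod baer (\<lambda>i. norm c y) {1..<p}"
    using cM xy by (intro L.finprod_cong') (auto simp: sum_conj_pow[OF xy c])
  finally show ?thesis
    using cM xy by (simp add: L.finprod_const baer_pow)
qed

text \<open>\<open>norm_eq\<close> is applied to (y, y^j x), whose commutator is
  \<open>inv c\<close>. Summed over j, the moments cancel by \<open>sum_moment\<close>, and
  \<open>sum_norm\<close> evaluates the norms.\<close>

lemma commutator_pow_p_identity:
  assumes xy: "x \<in> carrier G" "y \<in> carrier G" and c: "c = \<lblot>x, y\<rblot>"
  shows "c [^] p \<oplus> norm c y [^] (p - 1) \<oplus> finprod baer (\<lambda>j. \<lblot>y, (y [^] j \<otimes> x) [^] p\<rblot>) {..<p} = \<one>"
proof -
  have cM: "c \<in> M" using xy c by simp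
  let ?g = "\<lambda>j::nat. y [^] j \<otimes> x"
  have yg: "inv c = \<lblot>y, ?g j\<rblot>" for j
    using xy by (simp add: c inv_commutator commutator_mult_own_pow)
  have "inv (finprod baer (\<lambda>j. norm c (?g j)) {..<p}) = finprod baer (\<lambda>j. norm (inv c) (?g j)) {..<p}"
    using cM xy by (simp add: norm_inv finprod_inv)
  also have "\<dots> = finprod baer (\<lambda>j. \<lblot>y, ?g j [^] p\<rblot> \<oplus> moment c (?g j) [^] half) {..<p}"
    using cM xy by (intro L.finprod_cong') (auto simp: norm_eq[OF _ _ yg] moment_inv)
  also have "\<dots> = finprod baer (\<lambda>j. \<lblot>y, ?g j [^] p\<rblot>) {..<p} \<oplus> finprod baer (\<lambda>j. moment c (?g j)) {..<p} [^] half"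
    using cM xy by (subst L.finprod_multf) (auto simp: finprod_baer_pow)
  also have "\<dots> = finprod baer (\<lambda>j. \<lblot>y, ?g j [^] p\<rblot>) {..<p}"
    using cM xy by (simp add: sum_moment[OF xy c])
  finally have "finprod baer (\<lambda>j. \<lblot>y, ?g j [^] p\<rblot>) {..<p} = inv\<^bsub>baer\<^esub> (c [^] p \<oplus> norm c y [^] (p - 1))"
    using cM xy by (simp add: sum_norm[OF xy c] inv_baer)
  then show ?thesis using cM xy by simp
qed

text \<open>The exponent q kills all commutators with p-th powers, so only the moment part of
  \<open>norm c y\<close> survives.\<close>

lemma commutator_pow_identity:
  assumes q: "\<And>g h. g \<in> carrier G \<Longrightarrow> h \<in> carrier G \<Longrightarrow> \<lblot>g, h [^] p\<rblot> [^] (q::nat) = \<one>"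
    and xy: "x \<in> carrier G" "y \<in> carrier G" and c: "c = \<lblot>x, y\<rblot>"
  shows "(c [^] p) [^] q \<oplus> moment c y [^] (half * (p - 1) * q) = \<one>"
proof -
  have cM: "c \<in> M" using xy c by simp
  let ?s = "finprod baer (\<lambda>j. \<lblot>y, (y [^] j \<otimes> x) [^] p\<rblot>) {..<p}"
  have "norm c y [^] q = moment c y [^] (half * q)"
    using xy cM by (simp add: norm_eq[OF xy c] baer_pow_distrib q nat_pow_pow)
  then have "(norm c y [^] (p - 1)) [^] q = moment c y [^] (half * (p - 1) * q)"
    using xy cM by (simp add: nat_pow_pow mult_ac) (simp add: mult_ac flip: nat_pow_pow)
  moreover have "?s [^] q = \<one>" using xy by (simp add: finprod_baer_pow q)
  moreover have "(c [^] p \<oplus> norm c y [^] (p - 1) \<oplus> ?s) [^] q = \<one>"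
    by (simp only: commutator_pow_p_identity[OF xy c] nat_pow_one)
  ultimately show ?thesis using cM xy by (simp add: baer_pow_distrib)
qed

lemma norm_central':
  assumes xy: "x \<in> carrier G" "y \<in> carrier G"
  shows "norm \<lblot>x, y\<rblot> x \<in> center G"
proof -
  have "norm \<lblot>x, y\<rblot> x = inv (norm \<lblot>y, x\<rblot> x)"
    using xy norm_inv[of "\<lblot>y, x\<rblot>" x] by (simp add: inv_commutator)
  then show ?thesis
    using subgroup.m_inv_closed[OF subgroup_center norm_central[of y x]] xy by simp
qed

text \<open>Let B(l, u) be \<open>bform c\<close> at y^l x^u. The factor j turns the weight u along
  y^j x into uj, the y-coordinate of (y^j x)^u. With the moment along y supplying the row u = 0, the
  left side is the sum of l B(l, u) over the whole plane. For fixed l, the sum of B(l, u) over u is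
  a commutator of c with a conjugate of the central \<open>norm c x\<close>.\<close>

lemma weighted_sum_moment:
  assumes xy: "x \<in> carrier G" "y \<in> carrier G" and c: "c = \<lblot>x, y\<rblot>"
  shows "finprod baer (\<lambda>j. moment c (y [^] j \<otimes> x) [^] j) {..<p} \<oplus> moment c y = \<one>"
proof -
  have cM: "c \<in> M" using xy c by simp
  define h where "h l u = bform c (y [^] l \<otimes> x [^] u) [^] l" for l u :: nat
  have hM [simp]: "h l u \<in> M" for l u using cM xy by (simp add: h_def)
  have h_per: "h (l + p) u = h l u" for l u
  proof -
    have "c \<^bold>^ (y [^] (l + p) \<otimes> x [^] u) = c \<^bold>^ (y [^] p) \<^bold>^ (y [^] l \<otimes> x [^] u)"
      using cM xy by (simp add: conj_by_conj_by nat_pow_mult add.commute del: conj_by_pow_p flip: m_assoc)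
    then have "bform c (y [^] (l + p) \<otimes> x [^] u) = bform c (y [^] l \<otimes> x [^] u)"
      using cM xy by (simp add: bform_def)
    then show ?thesis using cM xy by (simp add: h_def bform_pow_p flip: nat_pow_mult)
  qed
  have h: "(bform c ((y [^] j \<otimes> x) [^] u) [^] u) [^] j = h (u * j) u" for j u
  proof -
    obtain d where "d \<in> M" "(y [^] j \<otimes> x) [^] u = y [^] (u * j) \<otimes> x [^] u \<otimes> d"
      using pow_mult_in_derived_coset[of "y [^] j" x u] xy by (auto simp: nat_pow_pow mult.commute)
    then show ?thesis using cM xy by (simp add: bform_mult_M h_def nat_pow_pow)
  qed
  have "finprod baer (\<lambda>j. moment c (y [^] j \<otimes> x) [^] j) {..<p}
      = finprod baer (\<lambda>j. finprod baer (\<lambda>u. h (u * j) u) {..<p}) {..<p}"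
    using cM xy by (simp add: moment_def finprod_baer_pow h)
  also have "\<dots> = finprod baer (\<lambda>u. finprod baer (\<lambda>j. h (u * j) u) {..<p}) {..<p}"
    by (intro L.finprod_swap) auto
  \<comment> \<open>In the row u = 0 the coordinate uj is constantly 0; for the other u it runs over
    all residues.\<close>
  also have "\<dots> = finprod baer (\<lambda>j. h (0 * j) 0) {..<p} \<oplus>
      finprod baer (\<lambda>u. finprod baer (\<lambda>j. h (u * j) u) {..<p}) {1..<p}"
    by (subst (2) lessThan_p, subst L.finprod_insert) auto
  also have "finprod baer (\<lambda>j. h (0 * j) 0) {..<p} = \<one>"
    by (simp add: h_def)
  also have "finprod baer (\<lambda>u. finprod baer (\<lambda>j. h (u * j) u) {..<p}) {1..<p}
      = finprod baer (\<lambda>u. finprod baer (\<lambda>l. h l u) {..<p}) {1..<p}"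
  proof (rule L.finprod_cong')
    fix u assume u: "u \<in> {1..<p}"
    show "finprod baer (\<lambda>j. h (u * j) u) {..<p} = finprod baer (\<lambda>l. h l u) {..<p}"
      using L.finprod_affine_periodic[of "\<lambda>l. h l u" p u 0] h_per p_pos u by (simp add: coprime_p)
  qed auto
  finally have 1: "finprod baer (\<lambda>j. moment c (y [^] j \<otimes> x) [^] j) {..<p}
      = finprod baer (\<lambda>u. finprod baer (\<lambda>l. h l u) {..<p}) {1..<p}" by simp
  have 2: "moment c y = finprod baer (\<lambda>l. h l 0) {..<p}"
    using xy by (simp add: moment_def h_def)
  have "finprod baer (\<lambda>u. bform c (y [^] l \<otimes> x [^] u)) {..<p} = \<one>" for l :: nat
  proof -
    \<comment> \<open>Commutativity modulo \<open>M\<close> brings x^u next to c, so that the sum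
      over u becomes a norm.\<close>
    have "bform c (y [^] l \<otimes> x [^] u) = \<lblot>c, c \<^bold>^ (x [^] u) \<^bold>^ (y [^] l)\<rblot>" for u :: nat
      using cM xy bform_mult_commute[of c "y [^] l" "x [^] u"] by (simp add: bform_def conj_by_conj_by)
    then have "finprod baer (\<lambda>u. bform c (y [^] l \<otimes> x [^] u)) {..<p} = \<lblot>c, norm c x \<^bold>^ (y [^] l)\<rblot>"
      using cM xy by (simp add: commutator_finprod_right conj_by_finprod norm_def)
    also have "\<dots> = \<one>"
      using cM xy norm_central'[OF xy]
      by (simp add: c conj_by_center commutator_eq_one_iff center_commute)
    finally show ?thesis .
  qed
  then have "finprod baer (\<lambda>l. finprod baer (\<lambda>u. h l u) {..<p}) {..<p} = \<one>"
    using cM xy by (simp add: h_def flip: finprod_baer_pow)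
  then have "finprod baer (\<lambda>u. finprod baer (\<lambda>l. h l u) {..<p}) {..<p} = \<one>"
    by (subst L.finprod_swap) auto
  moreover have "finprod baer (\<lambda>u. finprod baer (\<lambda>l. h l u) {..<p}) {..<p}
      = finprod baer (\<lambda>l. h l 0) {..<p} \<oplus> finprod baer (\<lambda>u. finprod baer (\<lambda>l. h l u) {..<p}) {1..<p}"
    by (subst (2) lessThan_p, subst L.finprod_insert) auto
  ultimately show ?thesis unfolding 1 2 by (simp add: L.m_comm)
qed

lemma finprod_pow_index:
  assumes "d \<in> M"
  shows "finprod baer (\<lambda>j. d [^] j) {..<n::nat} = d [^] (\<Sum>j<n. j)"
proof (induction n)
  case (Suc n)
  have "finprod baer (\<lambda>j. d [^] j) {..<Suc n} = d [^] n \<oplus> finprod baer (\<lambda>j. d [^] j) {..<n}"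
    using assms by (subst lessThan_Suc, subst L.finprod_insert) auto
  also have "\<dots> = d [^] (\<Sum>j<n. j) \<oplus> d [^] n"
    using assms by (simp add: Suc L.m_comm)
  also have "\<dots> = d [^]\<^bsub>baer\<^esub> ((\<Sum>j<n. j) + n)"
    using assms L.nat_pow_mult[of d "\<Sum>j<n. j" n] by (simp add: baer_pow)
  finally show ?case using assms by (simp add: baer_pow)
qed simp

text \<open>The identity for \<open>(y, y\<^sup>jx)\<close>, whose commutator is \<open>c\<^sup>-\<^sup>1\<close>, shows that the moments along all
  the \<open>y\<^sup>jx\<close> coincide. Their sum with weights \<open>j\<close> then vanishes, and hence so does the moment
  along \<open>y\<close>.\<close>

lemma commutator_pow_p_trivial:
  assumes triv: "\<And>g h. g \<in> carrier G \<Longrightarrow> h \<in> carrier G \<Longrightarrow> \<lblot>g, h [^] p\<rblot> = \<one>"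
    and xy: "x \<in> carrier G" "y \<in> carrier G"
  shows "\<lblot>x, y\<rblot> [^] p = \<one>"
proof -
  \<comment> \<open>With q = 1 the general identity makes [a, b]^p the inverse of ?m^(half (p - 1)),
    and this inverse is ?m^half because ?m^p is trivial.\<close>
  have half: "\<lblot>a, b\<rblot> [^] p = moment \<lblot>a, b\<rblot> b [^] half" if ab: "a \<in> carrier G" "b \<in> carrier G" for a b
  proof -
    let ?m = "moment \<lblot>a, b\<rblot> b"
    have m: "?m \<in> M" "?m [^] p = \<one>" using ab by (simp_all add: moment_pow_p)
    have "?m [^] (half * (p - 1)) \<oplus> ?m [^] half = \<one>"
    proof -
      have "half * (p - 1) + half = p * half" using p_pos by (cases p) (auto simp: algebra_simps)
      then have "?m [^]\<^bsub>baer\<^esub> (half * (p - 1)) \<oplus> ?m [^]\<^bsub>baer\<^esub> half = ?m [^] (p * half)"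
        using m by (subst L.nat_pow_mult) (simp_all add: baer_pow)
      then show ?thesis using m by (simp add: baer_pow flip: nat_pow_pow)
    qed
    moreover have "\<lblot>a, b\<rblot> [^] p \<oplus> ?m [^] (half * (p - 1)) = \<one>"
      using commutator_pow_identity[of 1 a b] ab triv by simp
    ultimately show ?thesis
      using m ab by (metis L.inv_equality L.inv_unique' M_commutator M_pow L.m_comm)
  qed
  show ?thesis
  \<comment> \<open>For p = 2 the weights 0 and 1 do not add up to a multiple of p, but
    \<open>M\<close> is commutative and every moment vanishes.\<close>
  proof (cases "p = 2")
    case True
    then have "bform c g = \<one>" if "c \<in> M" "g \<in> carrier G" for c g
      using that M_commute_if_p_eq_2 by (simp add: bform_def)
    then have "moment \<lblot>x, y\<rblot> y = \<one>"
      using xy by (simp add: moment_def)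
    then show ?thesis using half[OF xy] by simp
  next
    case False
    then have odd: "odd p" using prime_p primes_dvd_imp_eq two_is_prime_nat by blast
    then have h2: "half * 2 = Suc p" unfolding half_def by presburger
    define c where "c = \<lblot>x, y\<rblot>"
    have cM: "c \<in> M" using xy by (simp add: c_def)
    let ?g = "\<lambda>j::nat. y [^] j \<otimes> x"
    \<comment> \<open>Twice \<open>half\<close> is p + 1, which acts as 1 on elements of order
      dividing p. Squaring the half moment thus recovers the moment, in a form free of j.\<close>
    define d where "d = (inv c [^] p) [^] (2::nat)"
    have md: "moment c (?g j) = d" for j
    proof -
      let ?m = "moment c (?g j)"
      have "inv c = \<lblot>y, ?g j\<rblot>"
        using xy by (simp add: c_def inv_commutator commutator_mult_own_pow)
      then have "inv c [^] p = ?m [^] half"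
        using half[of y "?g j"] xy cM moment_inv[of c "?g j"] by simp
      then have "d = ?m [^] Suc p"
        using xy cM by (simp add: d_def nat_pow_pow h2)
      then show ?thesis using xy cM by (simp add: moment_pow_p)
    qed
    have dM: "d \<in> M" using cM by (simp add: d_def)
    have dp: "d [^] p = \<one>" using moment_pow_p[of c "?g 0"] md[of 0] cM xy by simp
    have "(\<Sum>j<p. j) = p * ((p - 1) div 2)"
    proof -
      obtain k where k: "p = 2 * k + 1" using odd oddE by blast
      have "(\<Sum>j<Suc n. j) = n * Suc n div 2" for n by (simp add: lessThan_Suc_atMost gauss_sum_nat[unfolded atLeast0AtMost])
      from this[of "2 * k"] show ?thesis using k by (simp add: mult.assoc mult.left_commute)
    qed
    then have "finprod baer (\<lambda>j. moment c (?g j) [^] j) {..<p} = \<one>"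
      unfolding md using dM dp by (simp add: finprod_pow_index flip: nat_pow_pow)
    then have "moment c y = \<one>"
      using weighted_sum_moment[OF xy c_def] cM xy by simp
    then show ?thesis using half[OF xy] by (simp add: c_def)
  qed
qed

text \<open>The cases for e decide the fate of the moment in \<open>commutator_pow_identity\<close>:
  if p * p divides e, the multiplier q = e/p contains p and kills it; for e = p,
  \<open>commutator_pow_p_trivial\<close> is needed.\<close>

lemma derived_pow_trivial:
  assumes central: "\<And>x. x \<in> carrier G \<Longrightarrow> x [^] e \<in> center G"
    and e: "e = 1 \<or> e = p \<or> p * p dvd e"
    and w: "w \<in> M"
  shows "w [^] (e::nat) = \<one>"
proof (cases "e = 1")
  case True
  then have "x \<in> center G" if "x \<in> carrier G" for x using central[OF that] that by simp
  then have "M \<subseteq> {\<one>}"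
    by (intro derived_subset_subgroup triv_subgroup) (simp add: commutator_eq_one_iff center_commute)
  then show ?thesis using w by auto
next
  case False
  then have "p dvd e" using e by (auto elim: dvd_mult_left)
  then obtain q where q: "e = p * q" by blast
  have pq: "\<lblot>g, h [^] p\<rblot> [^] q = \<one>" if gh: "g \<in> carrier G" "h \<in> carrier G" for g h
  proof -
    have "\<lblot>h [^] p, g\<rblot> [^] q = \<lblot>h [^] e, g\<rblot>"
      using gh commutator_pow_left[of "h [^] p" g q] by (simp add: commutator_pow_p_central nat_pow_pow q)
    also have "\<dots> = \<one>" using gh central by (simp add: commutator_eq_one_iff center_commute)
    finally show ?thesis
      using gh by (simp add: nat_pow_inv flip: inv_commutator[of "h [^] p" g])
  qed
  have comm: "\<lblot>x, y\<rblot> [^] e = \<one>" if xy: "x \<in> carrier G" "y \<in> carrier G" for x y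
  proof (cases "e = p")
    case True
    then have "q = 1" using q p_pos by simp
    then show ?thesis using commutator_pow_p_trivial[of x y] pq xy True by simp
  next
    case False
    then have "p * p dvd e" using e \<open>e \<noteq> 1\<close> by blast
    then obtain r where r: "q = p * r" using q p_pos by auto
    have "moment \<lblot>x, y\<rblot> y [^] (half * (p - 1) * q) = (moment \<lblot>x, y\<rblot> y [^] p) [^] (half * (p - 1) * r)"
      using xy by (simp add: nat_pow_pow r mult_ac)
    then have "moment \<lblot>x, y\<rblot> y [^] (half * (p - 1) * q) = \<one>"
      using xy by (simp add: moment_pow_p)
    then show ?thesis
      using commutator_pow_identity[OF pq xy refl] xy by (simp add: nat_pow_pow q)
  qed
  \<comment> \<open>Commutators only generate \<open>M\<close>. Powers are additive for the Baer
    sum, and a product differs from it by half a commutator, which \<open>comm\<close> also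
    covers.\<close>
  have "subgroup {w \<in> M. w [^] e = \<one>} G"
  proof
    fix u v assume uv: "u \<in> {w \<in> M. w [^] e = \<one>}" "v \<in> {w \<in> M. w [^] e = \<one>}"
    have "\<lblot>u, v\<rblot> [^] e = \<one>" using uv comm[of u v] by simp
    then have "(\<lblot>u, v\<rblot> [^] half) [^] e = \<one>"
      using uv by (simp add: nat_pow_pow mult.commute[of half]) (simp flip: nat_pow_pow)
    then show "u \<otimes> v \<in> {w \<in> M. w [^] e = \<one>}"
      using uv mult_eq_baer[of u v] by (simp add: baer_pow_distrib)
  qed (auto simp: nat_pow_inv)
  then have "M \<subseteq> {w \<in> M. w [^] e = \<one>}"
    by (rule derived_subset_subgroup) (simp add: comm)
  then show ?thesis using w by blast
qed

end

section \<open>Central extensions from cocycles\<close>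

lemma exponent_dvdI:
  assumes "group G" "n > 0" "\<And>x. x \<in> carrier G \<Longrightarrow> x [^]\<^bsub>G\<^esub> (n::nat) = \<one>\<^bsub>G\<^esub>"
  shows "exponent G dvd n"
proof -
  interpret group G by fact
  let ?P = "\<lambda>n::nat. n > 0 \<and> (\<forall>x\<in>carrier G. x [^]\<^bsub>G\<^esub> n = \<one>\<^bsub>G\<^esub>)"
  have P: "?P n" using assms by auto
  then have e: "exponent G = (LEAST n. ?P n)" unfolding exponent_def by (intro if_P) blast
  have Pe: "?P (exponent G)" unfolding e using P by (rule LeastI)
  have "?P (n mod exponent G)" if "n mod exponent G > 0"
  proof -
    have "x [^]\<^bsub>G\<^esub> (n mod exponent G) = \<one>\<^bsub>G\<^esub>" if "x \<in> carrier G" for x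
    proof -
      have "ord x dvd exponent G" "ord x dvd n" using Pe P that by (auto simp: pow_eq_id)
      then show ?thesis using that by (simp add: pow_eq_id dvd_mod)
    qed
    then show ?thesis using that by blast
  qed
  moreover have "\<not> ?P (n mod exponent G)"
    using Pe mod_less_divisor[of "exponent G" n] not_less_Least[of "n mod exponent G" ?P] e by simp
  ultimately show ?thesis by (auto simp: dvd_eq_mod_eq_0)
qed

lemma pow_exponent:
  assumes "x \<in> carrier G" "exponent G > 0"
  shows "x [^]\<^bsub>G\<^esub> exponent G = \<one>\<^bsub>G\<^esub>"
proof -
  let ?P = "\<lambda>n::nat. n > 0 \<and> (\<forall>x\<in>carrier G. x [^]\<^bsub>G\<^esub> n = \<one>\<^bsub>G\<^esub>)"
  have ex: "\<exists>n. ?P n" using assms(2) unfolding exponent_def by (rule contrapos_pp) (subst if_not_P, auto)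
  then have "exponent G = (LEAST n. ?P n)"
    unfolding exponent_def by (intro if_P) blast
  moreover have "?P (LEAST n. ?P n)" using ex by (rule LeastI_ex)
  ultimately show ?thesis using assms(1) by simp
qed

lemma (in comm_group) conj_cancel:
  "a \<in> carrier G \<Longrightarrow> c \<in> carrier G \<Longrightarrow> inv c \<otimes> a \<otimes> c = a"
  by (simp add: m_comm[of "inv c"] m_assoc)

locale central_extension_cocycle = G: group G + A: comm_group A
  for G (structure) and A :: "('c, 'd) monoid_scheme" +
  fixes f
  assumes cocycle_closed [simp]: "g \<in> carrier G \<Longrightarrow> h \<in> carrier G \<Longrightarrow> f g h \<in> carrier A"
    and cocycle: "g \<in> carrier G \<Longrightarrow> h \<in> carrier G \<Longrightarrow> k \<in> carrier G \<Longrightarrow>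
      f h k \<otimes>\<^bsub>A\<^esub> f g (h \<otimes> k) = f (g \<otimes> h) k \<otimes>\<^bsub>A\<^esub> f g h"
begin

text \<open>The bar cocycle is not normalized: [1|1] has boundary [1], so its class is not zero.
  Hence the second component of the unit.\<close>

definition ext :: "('a \<times> 'c) monoid" where
  "ext = \<lparr>carrier = carrier G \<times> carrier A,
     monoid.mult = \<lambda>(g, a) (h, b). (g \<otimes> h, a \<otimes>\<^bsub>A\<^esub> b \<otimes>\<^bsub>A\<^esub> f g h),
     one = (\<one>, inv\<^bsub>A\<^esub> f \<one> \<one>)\<rparr>"

lemma ext_simps [simp]:
  "carrier ext = carrier G \<times> carrier A"
  "(g, a) \<otimes>\<^bsub>ext\<^esub> (h, b) = (g \<otimes> h, a \<otimes>\<^bsub>A\<^esub> b \<otimes>\<^bsub>A\<^esub> f g h)"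
  "\<one>\<^bsub>ext\<^esub> = (\<one>, inv\<^bsub>A\<^esub> f \<one> \<one>)"
  by (simp_all add: ext_def)

lemma cocycle_one:
  assumes "g \<in> carrier G"
  shows "f \<one> g = f \<one> \<one>" "f g \<one> = f \<one> \<one>"
  using assms cocycle[of \<one> \<one> g] cocycle[of g \<one> \<one>] by simp_all

lemma group_ext: "group ext"
proof (rule groupI)
  fix x y z assume "x \<in> carrier ext" "y \<in> carrier ext" "z \<in> carrier ext"
  then obtain g a h b k c where *: "x = (g, a)" "y = (h, b)" "z = (k, c)"
    "g \<in> carrier G" "h \<in> carrier G" "k \<in> carrier G" "a \<in> carrier A" "b \<in> carrier A" "c \<in> carrier A"
    by auto
  have "a \<otimes>\<^bsub>A\<^esub> b \<otimes>\<^bsub>A\<^esub> f g h \<otimes>\<^bsub>A\<^esub> c \<otimes>\<^bsub>A\<^esub> f (g \<otimes> h) k = a \<otimes>\<^bsub>A\<^esub> b \<otimes>\<^bsub>A\<^esub> c \<otimes>\<^bsub>A\<^esub> (f (g \<otimes> h) k \<otimes>\<^bsub>A\<^esub> f g h)"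
    using * by (simp add: A.m_ac)
  also have "\<dots> = a \<otimes>\<^bsub>A\<^esub> (b \<otimes>\<^bsub>A\<^esub> c \<otimes>\<^bsub>A\<^esub> f h k) \<otimes>\<^bsub>A\<^esub> f g (h \<otimes> k)"
    using * by (simp add: A.m_assoc flip: cocycle)
  finally show "x \<otimes>\<^bsub>ext\<^esub> y \<otimes>\<^bsub>ext\<^esub> z = x \<otimes>\<^bsub>ext\<^esub> (y \<otimes>\<^bsub>ext\<^esub> z)"
    using * by (simp add: G.m_assoc)
next
  fix x assume "x \<in> carrier ext"
  then obtain g a where *: "x = (g, a)" "g \<in> carrier G" "a \<in> carrier A" by auto
  show "\<one>\<^bsub>ext\<^esub> \<otimes>\<^bsub>ext\<^esub> x = x"
    using * cocycle_one[of g] by (simp add: A.conj_cancel)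
  \<comment> \<open>Chosen to cancel a and f (inv g) g and to leave the second component of the
    unit.\<close>
  let ?b = "inv\<^bsub>A\<^esub> f \<one> \<one> \<otimes>\<^bsub>A\<^esub> inv\<^bsub>A\<^esub> f (inv g) g \<otimes>\<^bsub>A\<^esub> inv\<^bsub>A\<^esub> a"
  have "?b \<otimes>\<^bsub>A\<^esub> a \<otimes>\<^bsub>A\<^esub> f (inv g) g = inv\<^bsub>A\<^esub> f \<one> \<one> \<otimes>\<^bsub>A\<^esub> (inv\<^bsub>A\<^esub> f (inv g) g \<otimes>\<^bsub>A\<^esub> (inv\<^bsub>A\<^esub> a \<otimes>\<^bsub>A\<^esub> a) \<otimes>\<^bsub>A\<^esub> f (inv g) g)"
    using * by (simp only: A.m_assoc A.m_closed A.inv_closed cocycle_closed G.inv_closed G.one_closed)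
  then have "(inv g, ?b) \<otimes>\<^bsub>ext\<^esub> x = \<one>\<^bsub>ext\<^esub>" using * by simp
  moreover have "(inv g, ?b) \<in> carrier ext" using * by simp
  ultimately show "\<exists>y\<in>carrier ext. y \<otimes>\<^bsub>ext\<^esub> x = \<one>\<^bsub>ext\<^esub>" by blast
qed auto

lemma fst_hom: "group_hom ext G fst"
  using group_ext by (auto simp: group_hom_def group_hom_axioms_def hom_def)

lemma fst_one_center:
  assumes "x \<in> carrier ext" "fst x = \<one>"
  shows "x \<in> center ext"
proof -
  obtain a where a: "x = (\<one>, a)" "a \<in> carrier A" using assms by (cases x) auto
  have "x \<otimes>\<^bsub>ext\<^esub> y = y \<otimes>\<^bsub>ext\<^esub> x" if "y \<in> carrier ext" for y
  proof -
    obtain h b where y: "y = (h, b)" "h \<in> carrier G" "b \<in> carrier A"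
      using \<open>y \<in> carrier ext\<close> by (cases y) auto
    then show ?thesis using a cocycle_one[of h] A.m_comm[of a b] by simp
  qed
  then show ?thesis using assms(1) unfolding center_def by blast
qed

text \<open>The shift by the unit's second component makes this a homomorphism.\<close>

definition incl :: "'c \<Rightarrow> 'a \<times> 'c" where
  "incl a = (\<one>, a \<otimes>\<^bsub>A\<^esub> inv\<^bsub>A\<^esub> f \<one> \<one>)"

lemma incl_hom: "incl \<in> hom A ext"
proof (rule homI)
  fix a b assume ab: "a \<in> carrier A" "b \<in> carrier A"
  have "a \<otimes>\<^bsub>A\<^esub> inv\<^bsub>A\<^esub> f \<one> \<one> \<otimes>\<^bsub>A\<^esub> (b \<otimes>\<^bsub>A\<^esub> inv\<^bsub>A\<^esub> f \<one> \<one>) \<otimes>\<^bsub>A\<^esub> f \<one> \<one> = a \<otimes>\<^bsub>A\<^esub> b \<otimes>\<^bsub>A\<^esub> inv\<^bsub>A\<^esub> f \<one> \<one>"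
    using ab by (simp add: A.m_assoc A.m_comm[of "inv\<^bsub>A\<^esub> f \<one> \<one>" b])
  then show "incl (a \<otimes>\<^bsub>A\<^esub> b) = incl a \<otimes>\<^bsub>ext\<^esub> incl b" by (simp add: incl_def)
qed (simp add: incl_def)

lemma incl_eq_one_iff: "a \<in> carrier A \<Longrightarrow> incl a = \<one>\<^bsub>ext\<^esub> \<longleftrightarrow> a = \<one>\<^bsub>A\<^esub>"
  using A.r_cancel_one[of "inv\<^bsub>A\<^esub> f \<one> \<one>" a] by (simp add: incl_def)

end

section \<open>The extension defined by the bar complex\<close>

lemma hom_free_Abelian_group_eq:
  assumes "h \<in> hom (free_Abelian_group S) H" "k \<in> hom (free_Abelian_group S) H" "group H"
    and eq: "\<And>s. s \<in> S \<Longrightarrow> h (frag_of s) = k (frag_of s)"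
    and "Poly_Mapping.keys z \<subseteq> S"
  shows "h z = k z"
proof -
  interpret h: group_hom "free_Abelian_group S" H h
    using assms by (simp add: group_hom_def group_hom_axioms_def)
  interpret k: group_hom "free_Abelian_group S" H k
    using assms by (simp add: group_hom_def group_hom_axioms_def)
  show ?thesis
  proof (rule free_Abelian_group_induct[OF assms(5)])
    fix a b assume ab: "Poly_Mapping.keys a \<subseteq> S" "Poly_Mapping.keys b \<subseteq> S" "h a = k a" "h b = k b"
    then show "h (a - b) = k (a - b)"
      using h.hom_mult[of a "- b"] k.hom_mult[of a "- b"] h.hom_inv[of b] k.hom_inv[of b]
      by simp
  qed (use eq h.hom_one k.hom_one in auto)
qed

locale bar_extension = group
begin

abbreviation chains :: "('a \<times> 'a \<Rightarrow>\<^sub>0 int) monoid"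
  where "chains \<equiv> free_Abelian_group (carrier G \<times> carrier G)"

abbreviation cls :: "('a \<times> 'a \<Rightarrow>\<^sub>0 int) \<Rightarrow> ('a \<times> 'a \<Rightarrow>\<^sub>0 int) set"
  where "cls z \<equiv> schur_boundaries G #>\<^bsub>chains\<^esub> z"

lemma normal_boundaries: "schur_boundaries G \<lhd> chains"
  using comm_group.normal_iff_subgroup[OF abelian_free_Abelian_group] subgroup_schur_boundaries
    group_axioms by blast

lemma cls_eq_iff: "Poly_Mapping.keys z \<subseteq> carrier G \<times> carrier G \<Longrightarrow>
    cls z = schur_boundaries G \<longleftrightarrow> z \<in> schur_boundaries G"
  using group.coset_join1[OF group_free_Abelian_group _ _ subgroup_schur_boundaries[OF group_axioms], of z]
    group.coset_join2[OF group_free_Abelian_group _ subgroup_schur_boundaries[OF group_axioms], of z]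
  by auto

lemma cls_hom: "cls \<in> hom chains (chains Mod schur_boundaries G)"
  using normal.r_coset_hom_Mod[OF normal_boundaries] .

lemma cls_add:
  assumes "Poly_Mapping.keys a \<subseteq> carrier G \<times> carrier G" "Poly_Mapping.keys b \<subseteq> carrier G \<times> carrier G"
  shows "cls a \<otimes>\<^bsub>chains Mod schur_boundaries G\<^esub> cls b = cls (a + b)"
  using hom_mult[OF cls_hom, of a b] assms by simp

text \<open>All 2-chains are kept, not only cycles: [g|h] is never a cycle, its boundary having
  coefficient sum 1, and the cocycle needs its class.\<close>

sublocale ext: central_extension_cocycle G "chains Mod schur_boundaries G" "\<lambda>g h. cls (frag_of (g, h))"
proof (intro central_extension_cocycle.intro central_extension_cocycle_axioms.intro)
  let ?A = "chains Mod schur_boundaries G"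
  show A: "comm_group ?A"
    using comm_group.abelian_FactGroup[OF abelian_free_Abelian_group subgroup_schur_boundaries[OF group_axioms]] .
  show "cls (frag_of (g, h)) \<in> carrier (chains Mod schur_boundaries G)"
    if "g \<in> carrier G" "h \<in> carrier G" for g h
    using that by (intro hom_in_carrier[OF cls_hom]) simp
  fix g h k assume ghk: "g \<in> carrier G" "h \<in> carrier G" "k \<in> carrier G"
  \<comment> \<open>The two sides of the cocycle identity differ by this boundary of
    [g|h|k].\<close>
  define b where "b = bar_d3 G (frag_of (g, h, k))"
  have b: "b \<in> schur_boundaries G"
    using ghk by (auto simp: b_def schur_boundaries_def)
  then have bk: "Poly_Mapping.keys b \<subseteq> carrier G \<times> carrier G"
    using subgroup.mem_carrier[OF subgroup_schur_boundaries[OF group_axioms]] by auto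
  have "cls (frag_of (h, k) + frag_of (g, h \<otimes> k))
      = cls (b + (frag_of (g \<otimes> h, k) + frag_of (g, h)))"
    by (simp add: b_def bar_d3_def)
  also have "\<dots> = cls b \<otimes>\<^bsub>chains Mod schur_boundaries G\<^esub> cls (frag_of (g \<otimes> h, k) + frag_of (g, h))"
    using ghk bk keys_add[of "frag_of (g \<otimes> h, k)" "frag_of (g, h)"] by (intro cls_add[symmetric]) auto
  also have "\<dots> = cls (frag_of (g \<otimes> h, k) + frag_of (g, h))"
  proof -
    have "cls (frag_of (g \<otimes> h, k) + frag_of (g, h)) \<in> carrier ?A"
      using ghk keys_add[of "frag_of (g \<otimes> h, k)" "frag_of (g, h)"]
      by (intro hom_in_carrier[OF cls_hom]) auto
    moreover have "cls b = \<one>\<^bsub>?A\<^esub>" using b bk by (simp add: cls_eq_iff)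
    ultimately show ?thesis
      using monoid.l_one[OF comm_monoid.axioms(1)[OF comm_group.axioms(1)[OF A]]] by simp
  qed
  finally show "cls (frag_of (h, k)) \<otimes>\<^bsub>chains Mod schur_boundaries G\<^esub> cls (frag_of (g, h \<otimes> k)) =
      cls (frag_of (g \<otimes> h, k)) \<otimes>\<^bsub>chains Mod schur_boundaries G\<^esub> cls (frag_of (g, h))"
    using ghk by (simp add: cls_add del: mult_FactGroup)
qed (rule group_axioms)

text \<open>The classes of the lifts \<open>(g, 1)\<close> in the abelianization of the extension define a map
  \<open>\<psi>\<close> from 1-chains; its composition with the boundary map sends a chain to its class.\<close>

lemma incl_cycle_derived:
  assumes z: "z \<in> schur_cycles G"
  shows "ext.incl (cls z) \<in> derived ext.ext (carrier ext.ext)"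
proof -
  let ?A = "chains Mod schur_boundaries G"
  let ?D = "derived ext.ext (carrier ext.ext)"
  let ?Q = "ext.ext Mod ?D"
  let ?\<pi> = "\<lambda>x. ?D #>\<^bsub>ext.ext\<^esub> x"
  interpret E: group ext.ext by (rule ext.group_ext)
  interpret D: normal ?D ext.ext by (rule E.derived_self_is_normal)
  interpret Q: comm_group ?Q by (rule E.derived_quot_is_comm_group)
  have \<pi>: "?\<pi> \<in> hom ext.ext ?Q" by (rule D.r_coset_hom_Mod)
  interpret \<pi>: group_hom ext.ext ?Q ?\<pi>
    using \<pi> by (intro group_hom.intro group_hom_axioms.intro E.group_axioms Q.group_axioms)
  have lift: "(g, \<one>\<^bsub>?A\<^esub>) \<in> carrier ext.ext" if "g \<in> carrier G" for g
    using that by (simp del: one_FactGroup)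
  obtain \<psi> where \<psi>: "\<psi> \<in> hom (free_Abelian_group (carrier G)) ?Q"
    "\<And>g. g \<in> carrier G \<Longrightarrow> \<psi> (frag_of g) = ?\<pi> (g, \<one>\<^bsub>?A\<^esub>)"
    using Q.free_Abelian_group_universal[of "\<lambda>g. ?\<pi> (g, \<one>\<^bsub>?A\<^esub>)" "carrier G"]
      \<pi>.hom_closed[OF lift] by blast
  interpret \<psi>: group_hom "free_Abelian_group (carrier G)" ?Q \<psi>
    using \<psi>(1) by (intro group_hom.intro group_hom_axioms.intro group_free_Abelian_group Q.group_axioms)
  have zc: "Poly_Mapping.keys z \<subseteq> carrier G \<times> carrier G" "bar_d2 G z = 0"
    using z by (auto simp: schur_cycles_def kernel_def)
  have "(?\<pi> \<circ> (ext.incl \<circ> cls)) z = (\<psi> \<circ> bar_d2 G) z"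
  proof (rule hom_free_Abelian_group_eq[OF _ _ Q.group_axioms _ zc(1)])
    show "?\<pi> \<circ> (ext.incl \<circ> cls) \<in> hom chains ?Q"
      by (intro Group.hom_compose[OF _ \<pi>] Group.hom_compose[OF cls_hom ext.incl_hom])
    show "\<psi> \<circ> bar_d2 G \<in> hom chains ?Q"
      by (intro Group.hom_compose[OF bar_d2_hom \<psi>(1)] group_axioms)
    fix s assume "s \<in> carrier G \<times> carrier G"
    then obtain g h where s: "s = (g, h)" "g \<in> carrier G" "h \<in> carrier G" by auto
    let ?f = "cls (frag_of (g, h))"
    have f: "?f \<in> carrier ?A" using s by simp
    have i: "ext.incl ?f \<in> carrier ext.ext" using hom_in_carrier[OF ext.incl_hom f] .
    \<comment> \<open>The class of [g|h] measures how far the lifts of g and h are from being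
      multiplicative.\<close>
    have "ext.incl ?f \<otimes>\<^bsub>ext.ext\<^esub> (g \<otimes> h, \<one>\<^bsub>?A\<^esub>) = (g, \<one>\<^bsub>?A\<^esub>) \<otimes>\<^bsub>ext.ext\<^esub> (h, \<one>\<^bsub>?A\<^esub>)"
      using s f by (simp add: ext.incl_def ext.cocycle_one(1)[of "g \<otimes> h"] ext.A.m_assoc del: one_FactGroup mult_FactGroup)
    then have "?\<pi> (ext.incl ?f) \<otimes>\<^bsub>?Q\<^esub> ?\<pi> (g \<otimes> h, \<one>\<^bsub>?A\<^esub>) = ?\<pi> (g, \<one>\<^bsub>?A\<^esub>) \<otimes>\<^bsub>?Q\<^esub> ?\<pi> (h, \<one>\<^bsub>?A\<^esub>)"
      using \<pi>.hom_mult[OF i lift[of "g \<otimes> h"]] \<pi>.hom_mult[OF lift lift, of g h] s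
      by (simp only: m_closed)
    then have "?\<pi> (ext.incl ?f) \<otimes>\<^bsub>?Q\<^esub> \<psi> (frag_of (g \<otimes> h)) = \<psi> (frag_of g) \<otimes>\<^bsub>?Q\<^esub> \<psi> (frag_of h)"
      using s by (simp only: \<psi>(2) m_closed)
    \<comment> \<open>The boundary of [g|h] plus [gh] is [g] + [h], so it satisfies the same
      relation under \<psi>, and the term of gh cancels.\<close>
    moreover have "\<psi> (bar_d2 G (frag_of (g, h))) \<otimes>\<^bsub>?Q\<^esub> \<psi> (frag_of (g \<otimes> h))
       = \<psi> (bar_d2 G (frag_of (g, h)) + frag_of (g \<otimes> h))"
      using s \<psi>.hom_mult[of "bar_d2 G (frag_of (g, h))" "frag_of (g \<otimes> h)"]
        hom_in_carrier[OF bar_d2_hom[OF group_axioms], of "frag_of (g, h)"]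
      by simp
    moreover have "\<dots> = \<psi> (frag_of g \<otimes>\<^bsub>free_Abelian_group (carrier G)\<^esub> frag_of h)"
      by (simp add: bar_d2_def add.commute)
    ultimately have "?\<pi> (ext.incl ?f) \<otimes>\<^bsub>?Q\<^esub> \<psi> (frag_of (g \<otimes> h))
       = \<psi> (bar_d2 G (frag_of (g, h))) \<otimes>\<^bsub>?Q\<^esub> \<psi> (frag_of (g \<otimes> h))"
      using s \<psi>.hom_mult[of "frag_of g" "frag_of h"] by simp
    moreover have "\<psi> (bar_d2 G (frag_of (g, h))) \<in> carrier ?Q" "\<psi> (frag_of (g \<otimes> h)) \<in> carrier ?Q"
      using s by (intro \<psi>.hom_closed hom_in_carrier[OF bar_d2_hom[OF group_axioms]]; simp)+
    ultimately have "?\<pi> (ext.incl ?f) = \<psi> (bar_d2 G (frag_of (g, h)))"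
      using Q.right_cancel[OF _ \<pi>.hom_closed[OF i]] by blast
    then show "(?\<pi> \<circ> (ext.incl \<circ> cls)) (frag_of s) = (\<psi> \<circ> bar_d2 G) (frag_of s)"
      using s by simp
  qed
  then have "?\<pi> (ext.incl (cls z)) = ?D"
    using zc \<psi>.hom_one by simp
  moreover have "ext.incl (cls z) \<in> carrier ext.ext"
    using zc by (intro hom_in_carrier[OF ext.incl_hom] hom_in_carrier[OF cls_hom]) simp
  ultimately show ?thesis
    using E.coset_join1[OF _ _ D.subgroup_axioms] by blast
qed

text \<open>The map \<open>incl\<close> is injective and sends classes of cycles into the derived
  subgroup, so the exponent bound pulls back.\<close>

lemma exponent_schur_multiplier_dvd:
  assumes w: "\<And>w. w \<in> derived ext.ext (carrier ext.ext) \<Longrightarrow> w [^]\<^bsub>ext.ext\<^esub> (n::nat) = \<one>\<^bsub>ext.ext\<^esub>"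
    and n: "n > 0"
  shows "exponent (schur_multiplier G) dvd n"
proof (rule exponent_dvdI[OF _ n])
  show "group (schur_multiplier G)"
    using comm_group_schur_multiplier[OF group_axioms] by (simp add: comm_group_def)
  let ?B = "schur_boundaries G"
  let ?Z = "chains\<lparr>carrier := schur_cycles G\<rparr>"
  note Z = subgroup_schur_cycles[OF group_axioms]
  have "comm_group ?Z"
    using subgroup.subgroup_is_group[OF Z group_free_Abelian_group]
    by (rule group.group_comm_groupI) (simp add: add.commute)
  then have B: "?B \<lhd> ?Z"
    using comm_group.normal_iff_subgroup group.subgroup_incl[OF group_free_Abelian_group
        subgroup_schur_boundaries[OF group_axioms] Z schur_boundaries_subset_cycles[OF group_axioms]]
    by blast
  interpret incl: group_hom "chains Mod ?B" ext.ext ext.incl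
    by (intro group_hom.intro group_hom_axioms.intro ext.incl_hom ext.group_ext ext.A.group_axioms)
  fix c assume "c \<in> carrier (schur_multiplier G)"
  then obtain z where z: "z \<in> schur_cycles G" "c = ?B #>\<^bsub>?Z\<^esub> z"
    by (auto simp: schur_multiplier_def carrier_FactGroup)
  have zk: "Poly_Mapping.keys z \<subseteq> carrier G \<times> carrier G"
    using subgroup.mem_carrier[OF Z z(1)] by simp
  then have zA: "cls z \<in> carrier (chains Mod ?B)"
    by (intro hom_in_carrier[OF cls_hom]) simp
  have pow: "z [^]\<^bsub>chains\<^esub> n \<in> carrier chains"
    using zk by (intro monoid.nat_pow_closed group.is_monoid group_free_Abelian_group) simp
  have cls_pow: "cls z [^]\<^bsub>chains Mod ?B\<^esub> n = cls (z [^]\<^bsub>chains\<^esub> n)"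
    using zk by (intro normal.FactGroup_pow[OF normal_boundaries]) simp
  have "ext.incl (cls z [^]\<^bsub>chains Mod ?B\<^esub> n) = \<one>\<^bsub>ext.ext\<^esub>"
    using incl.hom_nat_pow[OF zA, of n] w[OF incl_cycle_derived[OF z(1)]] by simp
  then have "cls (z [^]\<^bsub>chains\<^esub> n) = ?B"
    using ext.incl_eq_one_iff[OF ext.A.nat_pow_closed[OF zA, of n]] by (simp add: cls_pow)
  moreover have "c [^]\<^bsub>?Z Mod ?B\<^esub> n = ?B #>\<^bsub>?Z\<^esub> (z [^]\<^bsub>?Z\<^esub> n)"
    unfolding z(2) using z(1) by (intro normal.FactGroup_pow[OF B]) simp
  \<comment> \<open>The quotient of the cycles and that of all chains use the same coset; only the
    carriers differ.\<close>
  moreover have "\<dots> = cls (z [^]\<^bsub>chains\<^esub> n)"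
    by (simp add: r_coset_def nat_pow_def)
  ultimately show "c [^]\<^bsub>schur_multiplier G\<^esub> n = \<one>\<^bsub>schur_multiplier G\<^esub>"
    by (simp add: schur_multiplier_def)
qed

end

section \<open>From the group to its extension\<close>

lemma p_central_pow_center:
  assumes "group G" "p_central p G" "p > 0" "x \<in> carrier G"
  shows "x [^]\<^bsub>G\<^esub> p \<in> center G"
proof -
  interpret group G by fact
  have normal: "center G \<lhd> G"
  proof (intro normal_invI subgroup_center)
    fix g z assume gz: "g \<in> carrier G" "z \<in> center G"
    then have "g \<otimes>\<^bsub>G\<^esub> z \<otimes>\<^bsub>G\<^esub> inv\<^bsub>G\<^esub> g = z"
      by (simp add: center_closed m_assoc flip: center_commute[OF gz(2,1)])
    then show "g \<otimes>\<^bsub>G\<^esub> z \<otimes>\<^bsub>G\<^esub> inv\<^bsub>G\<^esub> g \<in> center G" using gz by simp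
  qed
  let ?X = "center G #>\<^bsub>G\<^esub> x"
  have X: "?X \<in> carrier (G Mod center G)" using assms by (auto simp: carrier_FactGroup)
  have dvd: "exponent (G Mod center G) dvd p" using assms by (simp add: p_central_def)
  \<comment> \<open>The code 0 for an infinite exponent divides only 0.\<close>
  then have pos: "exponent (G Mod center G) > 0" using assms(3) by (metis dvd_0_left_iff gr0I)
  obtain k where k: "p = exponent (G Mod center G) * k" using dvd by blast
  interpret Q: group "G Mod center G" using normal by (rule normal.factorgroup_is_group)
  have "?X [^]\<^bsub>G Mod center G\<^esub> p = \<one>\<^bsub>G Mod center G\<^esub>"
    using pow_exponent[OF X pos] X Q.nat_pow_pow[OF X, of "exponent (G Mod center G)" k, symmetric]
    unfolding k by (simp only: Q.nat_pow_one)
  then have "center G #>\<^bsub>G\<^esub> (x [^]\<^bsub>G\<^esub> p) = center G"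
    using normal.FactGroup_pow[OF normal assms(4), of p] by simp
  then show ?thesis
    using coset_join1[OF _ _ subgroup_center, of "x [^]\<^bsub>G\<^esub> p"] assms by simp
qed

text \<open>Element orders are powers of p dividing the exponent. If p * p does not divide it, they
  all divide p.\<close>

lemma p_group_exponent_cases:
  assumes "Factorial_Ring.prime p" "p_group p G" "exponent G > 0"
  shows "exponent G = 1 \<or> exponent G = p \<or> p * p dvd exponent G"
proof (cases "p * p dvd exponent G")
  case False
  interpret group G using assms by (simp add: p_group_def)
  have "exponent G dvd p"
  proof (rule exponent_dvdI)
    fix x assume x: "x \<in> carrier G"
    then obtain k where k: "ord x = p ^ k" using assms by (auto simp: p_group_def)
    then have "p ^ k dvd exponent G" using pow_exponent[OF x assms(3)] x by (simp add: pow_eq_id)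
    then have "k \<le> 1"
      using False by (metis dvd_trans le_imp_power_dvd not_less_eq_eq One_nat_def numeral_2_eq_2 power2_eq_square)
    then have "ord x dvd p" using k le_imp_power_dvd[of k 1 p] by simp
    then show "x [^]\<^bsub>G\<^esub> p = \<one>\<^bsub>G\<^esub>" using x by (simp add: pow_eq_id)
  qed (use assms prime_gt_0_nat group_axioms in auto)
  then show ?thesis using assms(1) prime_nat_iff by blast
qed blast

theorem theorem7p1:
  fixes G :: "('a, 'b) monoid_scheme" and p :: nat
  assumes "Factorial_Ring.prime p"
    and "p_group p G"
    and "p_central p G"
    and "metabelian G"
    and "exponent G > 0"
  shows "exponent (schur_multiplier G) dvd exponent G"
proof -
  interpret bar_extension G
    using assms by (simp add: bar_extension_def p_group_def)
  interpret E: group ext.ext by (rule ext.group_ext)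
  interpret \<pi>: group_hom ext.ext G fst by (rule ext.fst_hom)
  have comm: "fst (E.commutator x y) = commutator (fst x) (fst y)" if "x \<in> carrier ext.ext" "y \<in> carrier ext.ext" for x y
    using that unfolding E.commutator_def commutator_def
    by (simp only: \<pi>.hom_mult \<pi>.hom_inv E.m_closed E.inv_closed)
  \<comment> \<open>The commutators in question are trivial in G, so they lie in the kernel of
    \<open>fst\<close>, which is central.\<close>
  interpret C: p_central_metabelian_cover ext.ext p
  proof (intro p_central_metabelian_cover.intro p_central_metabelian_cover_axioms.intro E.group_axioms assms(1))
    fix x y assume xy: "x \<in> carrier ext.ext" "y \<in> carrier ext.ext"
    then have "fst x \<in> carrier G" "fst y \<in> carrier G" using \<pi>.hom_closed by blast+
    then have "commutator (fst x [^]\<^bsub>G\<^esub> p) (fst y) = \<one>\<^bsub>G\<^esub>"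
      using p_central_pow_center[OF group_axioms assms(3), of "fst x"] prime_gt_0_nat[OF assms(1)]
      by (simp add: commutator_eq_one_iff center_commute)
    then show "E.commutator (x [^]\<^bsub>ext.ext\<^esub> p) y \<in> center ext.ext"
      using xy by (intro ext.fst_one_center E.commutator_closed E.nat_pow_closed)
        (simp_all only: comm E.nat_pow_closed \<pi>.hom_nat_pow)
  next
    fix u v assume uv: "u \<in> derived ext.ext (carrier ext.ext)" "v \<in> derived ext.ext (carrier ext.ext)"
    have D: "derived ext.ext (carrier ext.ext) \<subseteq> carrier ext.ext"
      by (rule E.derived_in_carrier) simp
    have "fst ` derived ext.ext (carrier ext.ext) = derived G (fst ` carrier ext.ext)"
      by (rule \<pi>.derived_img[symmetric]) simp
    also have "\<dots> \<subseteq> derived G (carrier G)"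
      using \<pi>.hom_closed by (intro mono_derived) blast
    finally have "fst u \<in> derived G (carrier G)" "fst v \<in> derived G (carrier G)" using uv by blast+
    then have "fst u \<otimes>\<^bsub>G\<^esub> fst v = fst v \<otimes>\<^bsub>G\<^esub> fst u"
      using comm_groupE(4)[OF assms(4)[unfolded metabelian_def]] by simp
    moreover have "fst u \<in> carrier G" "fst v \<in> carrier G" using uv D \<pi>.hom_closed by blast+
    ultimately have "commutator (fst u) (fst v) = \<one>\<^bsub>G\<^esub>"
      by (simp add: commutator_eq_one_iff)
    then show "E.commutator u v \<in> center ext.ext"
      using uv D by (intro ext.fst_one_center E.commutator_closed) (auto simp only: comm subset_iff)
  qed
  have "x [^]\<^bsub>ext.ext\<^esub> exponent G \<in> center ext.ext" if "x \<in> carrier ext.ext" for x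
  proof (rule ext.fst_one_center)
    show "fst (x [^]\<^bsub>ext.ext\<^esub> exponent G) = \<one>\<^bsub>G\<^esub>"
      using that pow_exponent[OF \<pi>.hom_closed[OF that] assms(5)] by (simp only: \<pi>.hom_nat_pow)
  qed (use that E.nat_pow_closed in blast)
  then show ?thesis
    using C.derived_pow_trivial[of "exponent G"] p_group_exponent_cases[OF assms(1,2,5)] assms(5)
    by (intro exponent_schur_multiplier_dvd) blast+
qed

end
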